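(* Let $n\ge 3$ and let $A\in\mathbb{R}^{N\times N}$ be partitioned into blocks $A_{ij}\in\mathbb{R}^{N_i\times N_j}$, $1\le i,j\le n$, $N=N_1+\cdots+N_n$. Suppose $\hat X\in\mathbb{R}^{N_n\times N_1}$ and $\hat Y\in\mathbb{R}^{N_1\times N_n}$ satisfy $$\operatorname{rank}\mathcal{H}_i(\hat X)=\min_{X\in\mathbb{R}^{N_n\times N_1}}\operatorname{rank}\mathcal{H}_i(X)\quad\text{and}\quad \operatorname{rank}\mathcal{G}_i(\hat Y)=\min_{Y\in\mathbb{R}^{N_1\times N_n}}\operatorname{rank}\mathcal{G}_i(Y)$$ for $i=1,2,\ldots,n-1$. Then the CSS construction process (described in the context), run with $X=\hat X$ and $Y=\hat Y$, produces a CSS representation of $A$ which is uniformly minimal: if its state dimensions are $r^h_i,r^g_i$ ($1\le i\le n-1$), then for any other CSS representation of $A$, with state dimensions $\hat r^h_i,\hat r^g_i$, one has $$r^h_i\le\hat r^h_i\quad\text{and}\quad r^g_i\le\hat r^g_i\qquad\text{for } i=1,2,\ldots,n-1.$$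
   Context: Notation. $A(X,Y)$ denotes the matrix obtained from $A$ by replacing the corner block $A_{n1}$ by $X$ and $A_{1n}$ by $Y$. $\mathcal{H}_k(X)$ is the submatrix of $A(X,Y)$ in block rows $k+1,\ldots,n$ and block columns $1,\ldots,k$ (it depends only on $X$); $\mathcal{G}_k(Y)$ is the submatrix of $A(X,Y)$ in block rows $1,\ldots,k$ and block columns $k+1,\ldots,n$ (it depends only on $Y$). SSS representation. An SSS representation of a block matrix $M$ (same block sizes) with state dimensions $r^g_i,r^h_i\ge 0$ ($1\le i\le n-1$) is a collection of real matrices $U_i\in\mathbb{R}^{N_i\times r^g_i}$ ($1\le i\le n-1$), $W_i\in\mathbb{R}^{r^g_{i-1}\times r^g_i}$ ($2\le i\le n-1$), $V_i\in\mathbb{R}^{N_i\times r^g_{i-1}}$ ($2\le i\le n$), $D_i\in\mathbb{R}^{N_i\times N_i}$ ($1\le i\le n$), $P_i\in\mathbb{R}^{N_i\times r^h_{i-1}}$ ($2\le i\le n$), $R_i\in\mathbb{R}^{r^h_i\times r^h_{i-1}}$ ($2\le i\le n-1$), $Q_i\in\mathbb{R}^{N_i\times r^h_i}$ ($1\le i\le n-1$) such that $M_{kk}=D_k$, $M_{k\ell}=P_kR_{k-1}\cdots R_{\ell+1}Q_\ell^T$ for $k>\ell$, and $M_{k\ell}=U_kW_{k+1}\cdots W_{\ell-1}V_\ell^T$ for $k<\ell$. It is minimal if $r^h_i$ and $r^g_i$ equal the ranks of the submatrices of $M$ in block rows $i+1,\ldots,n$, block columns $1,\ldots,i$, and in block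 rows $1,\ldots,i$, block columns $i+1,\ldots,n$, respectively, for all $i$; minimal SSS representations always exist. CSS representation. A CSS (cycle semi-separable) representation of $A$ with state dimensions $r^g_i,r^h_i$ is a collection of matrices of the same kinds and sizes together with $U_0\in\mathbb{R}^{N_1\times r^g_{n-1}}$ and $P_0\in\mathbb{R}^{N_n\times r^h_1}$ such that the block entries of $A$ are given by the SSS formulas above except that $A_{1n}=U_1W_2\cdots W_{n-1}V_n^T+U_0V_n^T$ and $A_{n1}=P_nR_{n-1}\cdots R_2Q_1^T+P_0Q_1^T$. CSS construction process. Given $X,Y$: (1) Compute a minimal SSS representation of $A(X,Y)$; denote its matrices $\tilde Q_1,\tilde P_2,\tilde R_2,\tilde V_n,\tilde U_{n-1},\tilde W_{n-1}$ with a tilde and all the others without. (2) Compute a rank factorization $\begin{bmatrix}\tilde Q_1^T\\ A_{n1}-X\end{bmatrix}=ZQ_1^T$, where $Q_1^T$ has full row rank (its rows are a basis of the row space), and set $P_2=\tilde P_2\tilde Q_1^T(Q_1^T)^\dagger$, $R_2=\tilde R_2\tilde Q_1^T(Q_1^T)^\dagger$, $P_0=(A_{n1}-X)(Q_1^T)^\dagger$, where $^\dagger$ is the pseudoinverse. (3) Similarly compute a rank factorization $\begin{bmatrix}\tilde V_n^T\\ A_{1n}-Y\end{bmatrix}=Z'V_n^T$ with $V_n^T$ of full row rank, and set $U_{n-1}=\tilde U_{n-1}\tilde V_n^T(V_n^T)^\dagger$, $W_{n-1}=\tilde W_{n-1}\tilde V_n^T(V_n^T)^\dagger$, $U_0=(A_{1n}-Y)(V_n^T)^\dagger$.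 The output is the CSS representation with the tilde matrices replaced by the new ones; its dimension $r^h_1$ is the number of columns of $Q_1$, $r^g_{n-1}$ the number of columns of $V_n$, and the other dimensions are those of the SSS representation. *)

theory Defs
  imports "Jordan_Normal_Form.DL_Rank" "Jordan_Normal_Form.DL_Submatrix"
begin

definition mat_rank :: "real mat \<Rightarrow> nat" where
  "mat_rank A = vec_space.rank (dim_row A) A"

definition is_pinv :: "real mat \<Rightarrow> real mat \<Rightarrow> bool" where
  "is_pinv A B \<longleftrightarrow> B \<in> carrier_mat (dim_col A) (dim_row A) \<and>
     A * B * A = A \<and> B * A * B = B \<and> (A * B)\<^sup>T = A * B \<and> (B * A)\<^sup>T = B * A"

text \<open>The Moore-Penrose pseudoinverse.\<close>

definition pinv :: "real mat \<Rightarrow> real mat" where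
  "pinv A = (THE B. is_pinv A B)"

definition rank_factorization :: "real mat \<Rightarrow> real mat \<Rightarrow> real mat \<Rightarrow> bool" where
  "rank_factorization F Z B \<longleftrightarrow>
     Z \<in> carrier_mat (dim_row F) (dim_row B) \<and> B \<in> carrier_mat (dim_row B) (dim_col F) \<and>
     F = Z * B \<and> mat_rank B = dim_row B \<and> mat_rank F = dim_row B"

text \<open>Block indices run from \<open>1\<close> to \<open>n\<close>, with \<open>N i\<close> the size of block \<open>i\<close>; the entries of a
  matrix are indexed from \<open>0\<close>. So block \<open>i\<close> occupies the entry indices from \<open>offset N i\<close> up to,
  but excluding, \<open>offset N i + N i\<close>.\<close>

definition total_size :: "nat \<Rightarrow> (nat \<Rightarrow> nat) \<Rightarrow> nat" where
  "total_size n N = (\<Sum>i=1..n. N i)"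

definition offset :: "(nat \<Rightarrow> nat) \<Rightarrow> nat \<Rightarrow> nat" where
  "offset N i = (\<Sum>j=1..<i. N j)"

definition block_indices :: "(nat \<Rightarrow> nat) \<Rightarrow> nat set \<Rightarrow> nat set" where
  "block_indices N I = (\<Union>i\<in>I. {offset N i ..< offset N i + N i})"

definition block_submatrix :: "(nat \<Rightarrow> nat) \<Rightarrow> real mat \<Rightarrow> nat set \<Rightarrow> nat set \<Rightarrow> real mat" where
  "block_submatrix N M I J = submatrix M (block_indices N I) (block_indices N J)"

definition block :: "(nat \<Rightarrow> nat) \<Rightarrow> real mat \<Rightarrow> nat \<Rightarrow> nat \<Rightarrow> real mat" where
  "block N M i j = block_submatrix N M {i} {j}"

definition lower_submatrix :: "nat \<Rightarrow> (nat \<Rightarrow> nat) \<Rightarrow> real mat \<Rightarrow> nat \<Rightarrow> real mat" where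
  "lower_submatrix n N M k = block_submatrix N M {k+1..n} {1..k}"

definition upper_submatrix :: "nat \<Rightarrow> (nat \<Rightarrow> nat) \<Rightarrow> real mat \<Rightarrow> nat \<Rightarrow> real mat" where
  "upper_submatrix n N M k = block_submatrix N M {1..k} {k+1..n}"

text \<open>The matrix \<open>A(X,Y)\<close>: the block \<open>(n,1)\<close> of \<open>A\<close> becomes \<open>X\<close> and the block \<open>(1,n)\<close> becomes \<open>Y\<close>.\<close>

definition replace_corners ::
  "nat \<Rightarrow> (nat \<Rightarrow> nat) \<Rightarrow> real mat \<Rightarrow> real mat \<Rightarrow> real mat \<Rightarrow> real mat" where
  "replace_corners n N A X Y = mat (dim_row A) (dim_col A) (\<lambda>(i, j).
     if i \<in> block_indices N {n} \<and> j \<in> block_indices N {1}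
       then X $$ (i - offset N n, j - offset N 1)
     else if i \<in> block_indices N {1} \<and> j \<in> block_indices N {n}
       then Y $$ (i - offset N 1, j - offset N n)
     else A $$ (i, j))"

text \<open>\<open>\<H>\<^sub>k(X)\<close> and \<open>\<G>\<^sub>k(Y)\<close>. The corner that is not replaced by an argument keeps its value in \<open>A\<close>;
  for \<open>1 \<le> k < n\<close> it lies outside of the submatrix taken.\<close>

definition Hmat :: "nat \<Rightarrow> (nat \<Rightarrow> nat) \<Rightarrow> real mat \<Rightarrow> nat \<Rightarrow> real mat \<Rightarrow> real mat" where
  "Hmat n N A k X = lower_submatrix n N (replace_corners n N A X (block N A 1 n)) k"

definition Gmat :: "nat \<Rightarrow> (nat \<Rightarrow> nat) \<Rightarrow> real mat \<Rightarrow> nat \<Rightarrow> real mat \<Rightarrow> real mat" where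
  "Gmat n N A k Y = upper_submatrix n N (replace_corners n N A (block N A n 1) Y) k"

text \<open>The generators of a representation. Values at indices outside the ranges required by
  \<open>sss_dims\<close> are irrelevant.\<close>

record sss =
  rg :: "nat \<Rightarrow> nat"
  rh :: "nat \<Rightarrow> nat"
  Umat :: "nat \<Rightarrow> real mat"
  Wmat :: "nat \<Rightarrow> real mat"
  Vmat :: "nat \<Rightarrow> real mat"
  Dmat :: "nat \<Rightarrow> real mat"
  Pmat :: "nat \<Rightarrow> real mat"
  Rmat :: "nat \<Rightarrow> real mat"
  Qmat :: "nat \<Rightarrow> real mat"

record css = sss +
  U0mat :: "real mat"
  P0mat :: "real mat"

definition sss_dims :: "nat \<Rightarrow> (nat \<Rightarrow> nat) \<Rightarrow> 'a sss_scheme \<Rightarrow> bool" where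
  "sss_dims n N s \<longleftrightarrow>
     (\<forall>i\<in>{1..n-1}. Umat s i \<in> carrier_mat (N i) (rg s i)) \<and>
     (\<forall>i\<in>{2..n-1}. Wmat s i \<in> carrier_mat (rg s (i-1)) (rg s i)) \<and>
     (\<forall>i\<in>{2..n}. Vmat s i \<in> carrier_mat (N i) (rg s (i-1))) \<and>
     (\<forall>i\<in>{1..n}. Dmat s i \<in> carrier_mat (N i) (N i)) \<and>
     (\<forall>i\<in>{2..n}. Pmat s i \<in> carrier_mat (N i) (rh s (i-1))) \<and>
     (\<forall>i\<in>{2..n-1}. Rmat s i \<in> carrier_mat (rh s i) (rh s (i-1))) \<and>
     (\<forall>i\<in>{1..n-1}. Qmat s i \<in> carrier_mat (N i) (rh s i))"

text \<open>\<open>P\<^sub>k R\<^bsub>k-1\<^esub> \<cdots> R\<^bsub>l+1\<^esub> Q\<^sub>l\<^sup>T\<close> for \<open>k > l\<close> and \<open>U\<^sub>k W\<^bsub>k+1\<^esub> \<cdots> W\<^bsub>l-1\<^esub> V\<^sub>l\<^sup>T\<close> for \<open>k < l\<close>,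
  bracketed to the right.\<close>

definition lower_entry :: "'a sss_scheme \<Rightarrow> nat \<Rightarrow> nat \<Rightarrow> real mat" where
  "lower_entry s k l = Pmat s k * fold (\<lambda>i M. Rmat s i * M) [l+1..<k] (Qmat s l)\<^sup>T"

definition upper_entry :: "'a sss_scheme \<Rightarrow> nat \<Rightarrow> nat \<Rightarrow> real mat" where
  "upper_entry s k l = Umat s k * foldr (\<lambda>i M. Wmat s i * M) [k+1..<l] (Vmat s l)\<^sup>T"

definition is_sss :: "nat \<Rightarrow> (nat \<Rightarrow> nat) \<Rightarrow> real mat \<Rightarrow> sss \<Rightarrow> bool" where
  "is_sss n N M s \<longleftrightarrow> sss_dims n N s \<and>
     (\<forall>k\<in>{1..n}. \<forall>l\<in>{1..n}. block N M k l =
        (if k = l then Dmat s k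
         else if k > l then lower_entry s k l
         else upper_entry s k l))"

definition is_minimal_sss :: "nat \<Rightarrow> (nat \<Rightarrow> nat) \<Rightarrow> real mat \<Rightarrow> sss \<Rightarrow> bool" where
  "is_minimal_sss n N M s \<longleftrightarrow> is_sss n N M s \<and>
     (\<forall>i\<in>{1..n-1}. rh s i = mat_rank (lower_submatrix n N M i) \<and>
                    rg s i = mat_rank (upper_submatrix n N M i))"

definition is_css :: "nat \<Rightarrow> (nat \<Rightarrow> nat) \<Rightarrow> real mat \<Rightarrow> css \<Rightarrow> bool" where
  "is_css n N A c \<longleftrightarrow> sss_dims n N c \<and>
     U0mat c \<in> carrier_mat (N 1) (rg c (n-1)) \<and>
     P0mat c \<in> carrier_mat (N n) (rh c 1) \<and>
     (\<forall>k\<in>{1..n}. \<forall>l\<in>{1..n}. block N A k l =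
        (if k = l then Dmat c k
         else if k = n \<and> l = 1 then lower_entry c n 1 + P0mat c * (Qmat c 1)\<^sup>T
         else if k = 1 \<and> l = n then upper_entry c 1 n + U0mat c * (Vmat c n)\<^sup>T
         else if k > l then lower_entry c k l
         else upper_entry c k l))"

text \<open>The construction involves choices (the minimal SSS representation and the two rank
  factorizations), hence it is a relation: \<open>c\<close> is a possible output. Here \<open>s\<close> carries the
  matrices with a tilde, and \<open>Q1\<close>, \<open>Vn\<close> are the new \<open>Q\<^sub>1\<close>, \<open>V\<^sub>n\<close>.\<close>

definition css_construction ::
  "nat \<Rightarrow> (nat \<Rightarrow> nat) \<Rightarrow> real mat \<Rightarrow> real mat \<Rightarrow> real mat \<Rightarrow> css \<Rightarrow> bool" where
  "css_construction n N A X Y c \<longleftrightarrow> (\<exists>s Z Q1 Z' Vn.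
     is_minimal_sss n N (replace_corners n N A X Y) s \<and>
     rank_factorization ((Qmat s 1)\<^sup>T @\<^sub>r (block N A n 1 - X)) Z Q1\<^sup>T \<and>
     rank_factorization ((Vmat s n)\<^sup>T @\<^sub>r (block N A 1 n - Y)) Z' Vn\<^sup>T \<and>
     c = \<lparr> rg = (rg s)(n-1 := dim_col Vn),
           rh = (rh s)(1 := dim_col Q1),
           Umat = (Umat s)(n-1 := Umat s (n-1) * (Vmat s n)\<^sup>T * pinv (Vn\<^sup>T)),
           Wmat = (Wmat s)(n-1 := Wmat s (n-1) * (Vmat s n)\<^sup>T * pinv (Vn\<^sup>T)),
           Vmat = (Vmat s)(n := Vn),
           Dmat = Dmat s,
           Pmat = (Pmat s)(2 := Pmat s 2 * (Qmat s 1)\<^sup>T * pinv (Q1\<^sup>T)),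
           Rmat = (Rmat s)(2 := Rmat s 2 * (Qmat s 1)\<^sup>T * pinv (Q1\<^sup>T)),
           Qmat = (Qmat s)(1 := Q1),
           U0mat = (block N A 1 n - Y) * pinv (Vn\<^sup>T),
           P0mat = (block N A n 1 - X) * pinv (Q1\<^sup>T) \<rparr>)"

end

theory Submission
  imports Defs
begin

text \<open>For \<open>i \<ge> 2\<close> the dimension \<open>r\<^sup>h\<^sub>i\<close> produced by the construction is the minimal rank of
  \<open>\<H>\<^sub>i(X)\<close>. Any CSS representation, stripped of the term \<open>P\<^sub>0 Q\<^sub>1\<^sup>T\<close>, is an SSS representation of the
  lower part of \<open>A(X',Y)\<close> for some \<open>X'\<close>, so its dimension is at least the rank of \<open>\<H>\<^sub>i(X')\<close>. For
  \<open>i = 1\<close>, comparing with \<open>X' = 0\<close> shows that the rows of an optimal \<open>X\<close> are combinations of the rows of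
  \<open>A\<^sub>2\<^sub>1, \<dots>, A\<^bsub>n-1,1\<^esub>\<close>; and by minimality of the SSS representation the rows of \<open>Q\<^sub>1\<^sup>T\<close> with a tilde
  are combinations of the rows of \<open>\<H>\<^sub>1(X)\<close>. Hence all rows of the matrix factored in the second step of
  the construction lie in the row space of the first block column of \<open>A\<close> below the diagonal, which
  factors through \<open>Q\<^sub>1\<^sup>T\<close> of any CSS representation. Ranks enter only through factorizations: the rank
  of a matrix is its smallest inner dimension.\<close>

section \<open>Rank factorizations and the pseudoinverse\<close>

text \<open>Dimension 1 needs its own argument because the minimal rank of H_1(X) is in general too
  small there: with a first block column whose only nonzero block is A_n1, the minimum is 0. In a
  CSS representation P_0 Q_1^T starts from the same state as the chain, so the row space of Q_1^T
  must contain the rows of the whole first block column below the diagonal, A_n1 included. The rank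
  of that column is the true lower bound, and the work is to show that the factored matrix brings in
  no further rows.

  The half about U, W, V does not come from transposition: that would give U_1 the role of Q_1,
  whereas the construction changes V_n. Numbering the blocks backwards sends V_n, U_(n-1), W_(n-1),
  U_0 to Q_1, P_2, R_2, P_0 and the corner (1,n) to (n,1), so the lower argument applies as it
  stands. To make this possible it is carried out with abstract block selectors instead of index
  sets.\<close>

lemma mat_mult_assoc:
  "dim_col A = dim_row B \<Longrightarrow> dim_col B = dim_row C \<Longrightarrow> A * B * C = A * (B * C)"
  for A B C :: "real mat"
  by (rule assoc_mult_mat[of _ "dim_row A" "dim_row B" _ "dim_row C" _ "dim_col C"]) auto

lemma col_in_col_space:
  fixes C :: "real mat"
  assumes "C \<in> carrier_mat m r" "v \<in> LinearCombinations.module.span class_ring (module_vec TYPE(real) m) (set (cols C))"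
  shows "\<exists>x \<in> carrier_vec r. C *\<^sub>v x = v"
proof -
  interpret vec_space "TYPE(real)" m .
  have "v \<in> col_space C" using assms by (simp add: col_space_def)
  then show ?thesis using col_space_eq[OF assms(1)] assms(1) by auto
qed

text \<open>The columns of \<open>C\<close> are a maximal independent set of columns of
  \<open>A\<close>. By maximality every column of \<open>A\<close> lies in their span, and
  \<open>B\<close> collects the coordinates.\<close>

lemma factor_through_rank:
  assumes A: "A \<in> carrier_mat m n"
  shows "\<exists>C B. C \<in> carrier_mat m (mat_rank A) \<and> B \<in> carrier_mat (mat_rank A) n \<and> A = C * B"
proof -
  interpret vec_space "TYPE(real)" m .
  have Am: "set (cols A) \<subseteq> carrier_vec m" using cols_dim[of A] A by auto
  let ?P = "\<lambda>T. T \<subseteq> set (cols A) \<and> lin_indpt T"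
  have "?P {}" by (meson empty_subsetI fin_dim finite_basis_exists subset_li_is_li basis_def)
  then obtain S where S: "maximal S ?P" "finite S"
    using maximal_exists_superset[of "set (cols A)" ?P "{}"] by auto
  have SP: "S \<subseteq> set (cols A)" "lin_indpt S" using S(1) by (auto simp: maximal_def)
  have r: "mat_rank A = card S" using rank_card_indpt[OF A S(1)] A by (simp add: mat_rank_def)
  obtain ss where ss: "set ss = S" "distinct ss" using finite_distinct_list[OF S(2)] by auto
  have len: "length ss = card S" using ss distinct_card by metis
  define C where "C = mat_of_cols m ss"
  have C: "C \<in> carrier_mat m (card S)" by (simp add: C_def len flip: len)
  have cC: "cols C = ss" unfolding C_def using ss SP Am by (intro cols_mat_of_cols) auto
  have "\<exists>x \<in> carrier_vec (card S). C *\<^sub>v x = a" if a: "a \<in> set (cols A)" for a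
  proof (rule col_in_col_space[OF C], rule ccontr)
    assume n: "a \<notin> span (set (cols C))"
    then have n: "a \<notin> span S" by (simp add: cC ss)
    have SV: "S \<subseteq> carrier_vec m" using SP Am by auto
    have aS: "a \<notin> S" using n span_mem[OF SV] by auto
    have "lin_indpt (S \<union> {a})" using lin_dep_iff_in_span[OF _ SP(2) _ aS] SV a Am n by auto
    then have "?P (S \<union> {a})" using a SP by auto
    then have "S \<union> {a} = S" using S(1) unfolding maximal_def by blast
    then show False using aS by auto
  qed
  then obtain X where X: "\<And>a. a \<in> set (cols A) \<Longrightarrow> X a \<in> carrier_vec (card S) \<and> C *\<^sub>v X a = a"
    by metis
  define B where "B = mat_of_cols (card S) (map X (cols A))"
  have B: "B \<in> carrier_mat (card S) n" using A by (auto simp: B_def)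
  have "A = C * B"
  proof (rule mat_col_eqI)
    show "dim_row A = dim_row (C * B)" "dim_col A = dim_col (C * B)" using A B C by auto
    fix i assume i: "i < dim_col (C * B)"
    then have i: "i < n" using B by auto
    have iA: "col A i \<in> set (cols A)" using i A by (auto simp: cols_def)
    have "col B i = X (col A i)" unfolding B_def using i A X[OF iA]
      by (subst col_mat_of_cols) auto
    then show "col A i = col (C * B) i" using X[OF iA] col_mult2[OF C B i] by simp
  qed
  then show ?thesis using B C r by auto
qed

text \<open>The column space of \<open>C * B\<close> lies in that of \<open>C\<close>, which is
  spanned by \<open>k\<close> columns. Together with \<open>factor_through_rank\<close> this makes
  the rank the least inner dimension of a factorization; the rank inequalities for products and
  transposes come from these two facts by regrouping.\<close>

lemma mat_rank_mult_le:
  assumes C: "C \<in> carrier_mat m k" and B: "B \<in> carrier_mat k n"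
  shows "mat_rank (C * B) \<le> k"
proof -
  interpret vec_space "TYPE(real)" m .
  have CB: "C * B \<in> carrier_mat m n" using assms by auto
  have sC: "set (cols C) \<subseteq> carrier_vec m" using cols_dim[of C] C by auto
  have sCB: "set (cols (C*B)) \<subseteq> carrier_vec m" using cols_dim[of "C*B"] C by auto
  have "set (cols (C*B)) \<subseteq> span (set (cols C))"
  proof
    fix v assume "v \<in> set (cols (C*B))"
    then obtain i where i: "i < n" "v = col (C*B) i" using CB by (auto simp: cols_def)
    then have "v = C *\<^sub>v col B i" using col_mult2[OF C B] by auto
    then have "v \<in> col_space C" using col_space_eq[OF C] B C i by auto
    then show "v \<in> span (set (cols C))" by (simp add: col_space_def)
  qed
  then have sub: "span (set (cols (C*B))) \<subseteq> span (set (cols C))"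
    using sC span_is_subset span_is_submodule by auto
  have "rank (C*B) \<le> rank C" unfolding rank_def
    using vectorspace.subspace_dim[OF subspace_is_vs[OF span_is_subspace[OF sC]]
      nested_subspaces[OF span_is_subspace[OF sC] span_is_subspace[OF sCB] sub]
      fin_dim_span_cols[OF C]] fin_dim_span_cols[OF CB] by auto
  also have "\<dots> \<le> k" by (rule rank_le_nc[OF C])
  finally show ?thesis using C by (simp add: mat_rank_def)
qed

lemma mat_rank_le_dims:
  assumes "A \<in> carrier_mat m n"
  shows "mat_rank A \<le> m" "mat_rank A \<le> n"
  using mat_rank_mult_le[of "1\<^sub>m m" m m A n] mat_rank_mult_le[of A m n "1\<^sub>m n" n] assms by auto

lemma mat_rank_mult_left_le:
  assumes "A \<in> carrier_mat l m" "B \<in> carrier_mat m n"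
  shows "mat_rank (A * B) \<le> mat_rank B"
proof -
  obtain C D where CD: "C \<in> carrier_mat m (mat_rank B)" "D \<in> carrier_mat (mat_rank B) n" "B = C * D"
    using factor_through_rank[OF assms(2)] by blast
  have "A * B = A * C * D" by (subst CD(3)) (rule assoc_mult_mat[OF assms(1) CD(1,2), symmetric])
  then show ?thesis using mat_rank_mult_le[OF mult_carrier_mat[OF assms(1) CD(1)] CD(2)] by simp
qed

lemma mat_rank_mult_right_le:
  assumes "A \<in> carrier_mat l m" "B \<in> carrier_mat m n"
  shows "mat_rank (A * B) \<le> mat_rank A"
proof -
  obtain C D where CD: "C \<in> carrier_mat l (mat_rank A)" "D \<in> carrier_mat (mat_rank A) m" "A = C * D"
    using factor_through_rank[OF assms(1)] by blast
  have "A * B = C * (D * B)" by (subst CD(3)) (rule assoc_mult_mat[OF CD(1,2) assms(2)])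
  then show ?thesis using mat_rank_mult_le[OF CD(1) mult_carrier_mat[OF CD(2) assms(2)]] by simp
qed

text \<open>Transposing an optimal factorization keeps its inner dimension; this applied to
  \<open>A\<close> and to its transpose gives both inequalities.\<close>

lemma mat_rank_transpose: "mat_rank A\<^sup>T = mat_rank A"
proof -
  have "mat_rank A\<^sup>T \<le> mat_rank A" for A
  proof -
    let ?r = "mat_rank A"
    obtain C D where CD: "C \<in> carrier_mat (dim_row A) ?r" "D \<in> carrier_mat ?r (dim_col A)" "A = C * D"
      using factor_through_rank[of A "dim_row A" "dim_col A"] by blast
    have "A\<^sup>T = D\<^sup>T * C\<^sup>T" by (subst CD(3)) (rule transpose_mult[OF CD(1,2)])
    then show ?thesis using mat_rank_mult_le[of "D\<^sup>T" "dim_col A" ?r "C\<^sup>T" "dim_row A"] CD(1,2)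
      by simp
  qed
  from this[of A] this[of "A\<^sup>T"] show ?thesis by simp
qed

text \<open>A maximal independent set of columns has \<open>r\<close> elements, hence is a basis of
  the whole space. So every unit vector has a preimage under \<open>B\<close>, and these preimages
  are the columns of \<open>G\<close>.\<close>

lemma full_row_rank_right_inverse:
  assumes B: "B \<in> carrier_mat r n" and rk: "mat_rank B = r"
  shows "\<exists>G \<in> carrier_mat n r. B * G = 1\<^sub>m r"
proof -
  interpret vec_space "TYPE(real)" r .
  let ?P = "\<lambda>T. T \<subseteq> set (cols B) \<and> lin_indpt T"
  have Bm: "set (cols B) \<subseteq> carrier_vec r" using cols_dim[of B] B by auto
  have "?P {}" by (meson empty_subsetI fin_dim finite_basis_exists subset_li_is_li basis_def)
  then obtain S where S: "maximal S ?P" "finite S"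
    using maximal_exists_superset[of "set (cols B)" ?P "{}"] by auto
  have SP: "S \<subseteq> set (cols B)" "lin_indpt S" using S(1) by (auto simp: maximal_def)
  have "card S = r" using rank_card_indpt[OF B S(1)] B rk by (simp add: mat_rank_def)
  then have "basis S" using dim_li_is_basis[OF fin_dim S(2) _ SP(2)] dim_is_n SP Bm by auto
  then have "span S = carrier_vec r" by (simp add: basis_def)
  then have sp: "carrier_vec r \<subseteq> span (set (cols B))" using span_is_monotone[OF SP(1)] by auto
  have "\<exists>x \<in> carrier_vec n. B *\<^sub>v x = unit_vec r i" for i
    by (rule col_in_col_space[OF B]) (use sp in auto)
  then obtain X where X: "\<And>i. X i \<in> carrier_vec n" "\<And>i. B *\<^sub>v X i = unit_vec r i" by metis
  define G where "G = mat_of_cols n (map X [0..<r])"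
  have G: "G \<in> carrier_mat n r" by (auto simp: G_def)
  have "B * G = 1\<^sub>m r"
  proof (rule mat_col_eqI)
    fix i assume "i < dim_col (1\<^sub>m r :: real mat)"
    then have i: "i < r" by simp
    have "col G i = X i" unfolding G_def using i X by (subst col_mat_of_cols) auto
    then show "col (B * G) i = col (1\<^sub>m r) i" using col_mult2[OF B G i] X i by simp
  qed (use B G in auto)
  then show ?thesis using G by auto
qed

lemma full_col_rank_left_inverse:
  assumes A: "A \<in> carrier_mat m r" and "mat_rank A = r"
  shows "\<exists>L \<in> carrier_mat r m. L * A = 1\<^sub>m r"
proof -
  have "mat_rank A\<^sup>T = r" using assms by (simp add: mat_rank_transpose)
  then obtain G where G: "G \<in> carrier_mat m r" "A\<^sup>T * G = 1\<^sub>m r"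
    using full_row_rank_right_inverse[of "A\<^sup>T" r m] A by auto
  have "G\<^sup>T * A = (A\<^sup>T * G)\<^sup>T" using transpose_mult[of "A\<^sup>T" r m G r] A G(1) by simp
  then show ?thesis using G by (intro bexI[of _ "G\<^sup>T"]) auto
qed

lemma rank_factorization_exists: "\<exists>Z B. rank_factorization F Z B"
proof -
  let ?r = "mat_rank F"
  obtain C D where CD: "C \<in> carrier_mat (dim_row F) ?r" "D \<in> carrier_mat ?r (dim_col F)" "F = C * D"
    using factor_through_rank[of F "dim_row F" "dim_col F"] by blast
  have "mat_rank D = ?r"
    using mat_rank_mult_left_le[OF CD(1,2)] mat_rank_le_dims[OF CD(2)] CD(3) by auto
  then have "rank_factorization F C D" unfolding rank_factorization_def
    using CD(1,2) CD(3)[symmetric] by simp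
  then show ?thesis by blast
qed

text \<open>If \<open>B * B\<^sup>T\<close> kills \<open>v\<close>, then the scalar product of
  \<open>B\<^sup>T *\<^sub>v v\<close> with itself is 0, and over the reals this forces
  \<open>B\<^sup>T *\<^sub>v v\<close> to vanish. The transposed right inverse of \<open>B\<close>
  recovers \<open>v\<close> from it, so \<open>v\<close> is 0.\<close>

lemma gram_invertible:
  fixes B :: "real mat"
  assumes B: "B \<in> carrier_mat r n" and rk: "mat_rank B = r"
  shows "\<exists>K \<in> carrier_mat r r. B * B\<^sup>T * K = 1\<^sub>m r \<and> K * (B * B\<^sup>T) = 1\<^sub>m r"
proof -
  have BB: "B * B\<^sup>T \<in> carrier_mat r r" using B by auto
  obtain G where G: "G \<in> carrier_mat n r" "B * G = 1\<^sub>m r" using full_row_rank_right_inverse[OF assms] by auto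
  have "det (B * B\<^sup>T) \<noteq> 0"
  proof
    assume "det (B * B\<^sup>T) = 0"
    then obtain v where v: "v \<in> carrier_vec r" "v \<noteq> 0\<^sub>v r" "B * B\<^sup>T *\<^sub>v v = 0\<^sub>v r"
      using det_0_iff_vec_prod_zero_field[OF BB] by auto
    have Bv: "B\<^sup>T *\<^sub>v v \<in> carrier_vec n" using B v by auto
    have "(B\<^sup>T *\<^sub>v v) \<bullet> (B\<^sup>T *\<^sub>v v) = v \<bullet> (B *\<^sub>v (B\<^sup>T *\<^sub>v v))"
      using transpose_vec_mult_scalar[OF B Bv v(1)] by simp
    also have "B *\<^sub>v (B\<^sup>T *\<^sub>v v) = 0\<^sub>v r" using v B assoc_mult_mat_vec[of B r n "B\<^sup>T" r v] by auto
    finally have "(B\<^sup>T *\<^sub>v v) \<bullet> (B\<^sup>T *\<^sub>v v) = 0" using v by simp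
    then have z: "B\<^sup>T *\<^sub>v v = 0\<^sub>v n" using conjugate_square_eq_0_vec[OF Bv] by simp
    have "v = (B * G)\<^sup>T *\<^sub>v v" using G v by simp
    also have "\<dots> = G\<^sup>T *\<^sub>v (B\<^sup>T *\<^sub>v v)"
      using B G(1) v(1) by (subst transpose_mult[OF B G(1)], subst assoc_mult_mat_vec) auto
    also have "\<dots> = 0\<^sub>v r" unfolding z using G by auto
    finally show False using v by simp
  qed
  then have "B * B\<^sup>T \<in> Units (ring_mat TYPE(real) r ())" by (rule det_non_zero_imp_unit[OF BB])
  then show ?thesis by (auto simp: Units_def ring_mat_def)
qed
text \<open>Penrose's argument: \<open>A * X\<close> and \<open>A * Y\<close> are symmetric and each
  absorbs the other, so they coincide, and likewise \<open>X * A\<close> and \<open>Y * A\<close>.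
  It justifies the definite description in \<open>pinv\<close>.\<close>

lemma is_pinv_unique:
  assumes X: "is_pinv A X" and Y: "is_pinv A Y"
  shows "X = Y"
proof -
  let ?m = "dim_row A" and ?n = "dim_col A"
  have c: "A \<in> carrier_mat ?m ?n" "X \<in> carrier_mat ?n ?m" "Y \<in> carrier_mat ?n ?m"
    using X Y by (auto simp: is_pinv_def)
  have AX: "A * X = A * Y"
  proof -
    have "A * X = (A * Y * A) * X" using Y by (simp add: is_pinv_def)
    also have "\<dots> = (A * Y) * (A * X)" using c by (simp add: mat_mult_assoc)
    also have "\<dots> = (A * Y)\<^sup>T * (A * X)\<^sup>T" using X Y by (simp add: is_pinv_def)
    also have "\<dots> = ((A * X) * (A * Y))\<^sup>T" using c by (subst transpose_mult[of _ ?m ?m _ ?m]) auto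
    also have "(A * X) * (A * Y) = (A * X * A) * Y" using c by (simp add: mat_mult_assoc)
    also have "\<dots> = A * Y" using X by (simp add: is_pinv_def)
    finally show ?thesis using Y by (simp add: is_pinv_def)
  qed
  have XA: "X * A = Y * A"
  proof -
    have "X * A = X * (A * Y * A)" using Y by (simp add: is_pinv_def)
    also have "\<dots> = (X * A) * (Y * A)" using c by (simp add: mat_mult_assoc)
    also have "\<dots> = (X * A)\<^sup>T * (Y * A)\<^sup>T" using X Y by (simp add: is_pinv_def)
    also have "\<dots> = ((Y * A) * (X * A))\<^sup>T" using c by (subst transpose_mult[of _ ?n ?n _ ?n]) auto
    also have "(Y * A) * (X * A) = Y * (A * X * A)" using c by (simp add: mat_mult_assoc)
    also have "\<dots> = Y * A" using X by (simp add: is_pinv_def)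
    finally show ?thesis using Y by (simp add: is_pinv_def)
  qed
  have "X = X * A * X" using X by (simp add: is_pinv_def)
  also have "\<dots> = Y * (A * X)" using c by (simp add: XA mat_mult_assoc)
  also have "\<dots> = Y * A * Y" using c by (simp add: AX mat_mult_assoc)
  also have "\<dots> = Y" using Y by (simp add: is_pinv_def)
  finally show ?thesis .
qed

text \<open>For full row rank the pseudoinverse is \<open>B\<^sup>T * K\<close>, with
  \<open>K\<close> the inverse of the Gram matrix. That it is a right inverse is what lets
  \<open>pinv B * B\<close> act as the identity on the row space of \<open>B\<close>.\<close>

lemma pinv_full_row_rank:
  assumes B: "B \<in> carrier_mat r n" and rk: "mat_rank B = r"
  shows "pinv B \<in> carrier_mat n r" "B * pinv B = 1\<^sub>m r"
proof -
  obtain K where K: "K \<in> carrier_mat r r" "B * B\<^sup>T * K = 1\<^sub>m r" "K * (B * B\<^sup>T) = 1\<^sub>m r"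
    using gram_invertible[OF assms] by auto
  define X where "X = B\<^sup>T * K"
  have BT: "B\<^sup>T \<in> carrier_mat n r" using B by simp
  have X: "X \<in> carrier_mat n r" using BT K by (simp add: X_def)
  have BX: "B * X = 1\<^sub>m r" unfolding X_def using assoc_mult_mat[OF B BT K(1)] K(2) by simp
  \<comment> \<open>The inverse of a symmetric matrix is symmetric; this yields the last Penrose
    condition, the symmetry of \<open>X * B\<close>.\<close>
  have KT: "K\<^sup>T = K"
  proof -
    have BB: "B * B\<^sup>T \<in> carrier_mat r r" and KT: "K\<^sup>T \<in> carrier_mat r r" using B K(1) by auto
    have "(B * B\<^sup>T)\<^sup>T = B * B\<^sup>T" using transpose_mult[OF B BT] by simp
    then have "K\<^sup>T * (B * B\<^sup>T) = (B * B\<^sup>T * K)\<^sup>T" using transpose_mult[OF BB K(1)] by simp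
    then have 1: "K\<^sup>T * (B * B\<^sup>T) = 1\<^sub>m r" using K(2) by simp
    have "K\<^sup>T = K\<^sup>T * (B * B\<^sup>T * K)" using K(2) KT by simp
    also have "\<dots> = K\<^sup>T * (B * B\<^sup>T) * K" by (rule assoc_mult_mat[OF KT BB K(1), symmetric])
    also have "\<dots> = K" using 1 K(1) by simp
    finally show ?thesis .
  qed
  have "(X * B)\<^sup>T = B\<^sup>T * (B\<^sup>T * K)\<^sup>T" unfolding X_def[symmetric] using X B by (simp add: transpose_mult)
  also have "(B\<^sup>T * K)\<^sup>T = K * B" using transpose_mult[OF BT K(1)] KT by simp
  also have "B\<^sup>T * (K * B) = X * B" unfolding X_def using assoc_mult_mat[OF BT K(1) B] by simp
  finally have "is_pinv B X" unfolding is_pinv_def using X B BX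
    by (auto simp: assoc_mult_mat[of X n r B n X r])
  then have "is_pinv B (pinv B)" unfolding pinv_def
    by (rule theI[of "is_pinv B"]) (use is_pinv_unique \<open>is_pinv B X\<close> in blast)
  then have "pinv B = X" using is_pinv_unique \<open>is_pinv B X\<close> by blast
  then show "pinv B \<in> carrier_mat n r" "B * pinv B = 1\<^sub>m r" using X BX by auto
qed

section \<open>Generators of the lower triangular part\<close>

text \<open>The chain without its leading \<open>P k\<close>: the state that block column
  \<open>l\<close> sends to block row \<open>k\<close>. Plain functions replace the record fields so
  that the reversed \<open>U\<close>, \<open>W\<close>, \<open>V\<close> can take the roles of
  \<open>P\<close>, \<open>R\<close>, \<open>Q\<close>.\<close>

definition state :: "(nat \<Rightarrow> real mat) \<Rightarrow> (nat \<Rightarrow> real mat) \<Rightarrow> nat \<Rightarrow> nat \<Rightarrow> real mat" where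
  "state R Q k l = fold (\<lambda>i M. R i * M) [l+1..<k] (Q l)\<^sup>T"

text \<open>The state transition matrix of systems theory, from the state after block
  \<open>i\<close> to the state read by block \<open>k\<close>; the product is empty for
  \<open>k = i + 1\<close>.\<close>

definition transfer :: "(nat \<Rightarrow> nat) \<Rightarrow> (nat \<Rightarrow> real mat) \<Rightarrow> nat \<Rightarrow> nat \<Rightarrow> real mat" where
  "transfer r R k i = fold (\<lambda>i M. R i * M) [i+1..<k] (1\<^sub>m (r i))"

definition generators ::
  "nat \<Rightarrow> (nat \<Rightarrow> nat) \<Rightarrow> (nat \<Rightarrow> nat) \<Rightarrow> (nat \<Rightarrow> real mat) \<Rightarrow> (nat \<Rightarrow> real mat) \<Rightarrow> (nat \<Rightarrow> real mat) \<Rightarrow> bool"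
where
  "generators n N r P R Q \<longleftrightarrow>
     (\<forall>i\<in>{2..n}. P i \<in> carrier_mat (N i) (r (i-1))) \<and>
     (\<forall>i\<in>{2..n-1}. R i \<in> carrier_mat (r i) (r (i-1))) \<and>
     (\<forall>i\<in>{1..n-1}. Q i \<in> carrier_mat (N i) (r i))"

lemma state_Suc_self [simp]: "state R Q (Suc l) l = (Q l)\<^sup>T"
  by (simp add: state_def)

lemma state_Suc: "l < k \<Longrightarrow> state R Q (Suc k) l = R k * state R Q k l"
  by (simp add: state_def)

lemma transfer_Suc_self [simp]: "transfer r R (Suc i) i = 1\<^sub>m (r i)"
  by (simp add: transfer_def)

lemma transfer_Suc: "i < k \<Longrightarrow> transfer r R (Suc k) i = R k * transfer r R k i"
  by (simp add: transfer_def)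

context
  fixes n :: nat and N r :: "nat \<Rightarrow> nat" and P R Q :: "nat \<Rightarrow> real mat"
  assumes gen: "generators n N r P R Q"
begin

lemma P_carrier: "2 \<le> i \<Longrightarrow> i \<le> n \<Longrightarrow> P i \<in> carrier_mat (N i) (r (i-1))"
  and R_carrier: "2 \<le> i \<Longrightarrow> i < n \<Longrightarrow> R i \<in> carrier_mat (r i) (r (i-1))"
  and Q_carrier: "1 \<le> i \<Longrightarrow> i < n \<Longrightarrow> Q i \<in> carrier_mat (N i) (r i)"
  using gen by (auto simp: generators_def)

lemma state_carrier:
  assumes "1 \<le> l" "l < k" "k \<le> n"
  shows "state R Q k l \<in> carrier_mat (r (k-1)) (N l)"
  using \<open>l < k\<close> \<open>k \<le> n\<close>
proof (induction k rule: nat_less_induct)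
  case (1 k)
  show ?case
  proof (cases "k = Suc l")
    case True
    then show ?thesis using Q_carrier[of l] assms(1) 1(3) by auto
  next
    case False
    then obtain j where j: "k = Suc j" "l < j" using 1(2) by (cases k) auto
    have "state R Q j l \<in> carrier_mat (r (j-1)) (N l)" using 1 j by auto
    then show ?thesis using R_carrier[of j] j 1(3) assms(1) by (auto simp: state_Suc)
  qed
qed

lemma transfer_carrier:
  assumes "1 \<le> i" "i < k" "k \<le> n"
  shows "transfer r R k i \<in> carrier_mat (r (k-1)) (r i)"
  using \<open>i < k\<close> \<open>k \<le> n\<close>
proof (induction k rule: nat_less_induct)
  case (1 k)
  show ?case
  proof (cases "k = Suc i")
    case True
    then show ?thesis by auto
  next
    case False
    then obtain j where j: "k = Suc j" "i < j" using 1(2) by (cases k) auto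
    have "transfer r R j i \<in> carrier_mat (r (j-1)) (r i)" using 1 j by auto
    then show ?thesis using R_carrier[of j] j 1(3) assms(1) by (auto simp: transfer_Suc)
  qed
qed

text \<open>Cutting the product at \<open>i\<close> separates the dependence on the block row
  \<open>k\<close> from that on the block column \<open>l\<close>; the two parts meet in dimension
  \<open>r i\<close>, which is the source of the rank bounds.\<close>

lemma state_transfer:
  assumes "1 \<le> l" "l \<le> i" "i < k" "k \<le> n"
  shows "state R Q k l = transfer r R k i * state R Q (Suc i) l"
  using \<open>i < k\<close> \<open>k \<le> n\<close>
proof (induction k rule: nat_less_induct)
  case (1 k)
  have s: "state R Q (Suc i) l \<in> carrier_mat (r i) (N l)" using state_carrier[of l "Suc i"] assms by auto
  show ?case
  proof (cases "k = Suc i")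
    case True
    then show ?thesis using s by simp
  next
    case False
    then obtain j where j: "k = Suc j" "i < j" using 1(2) by (cases k) auto
    have "state R Q j l = transfer r R j i * state R Q (Suc i) l"
      by (rule 1(1)[rule_format]) (use j 1(3) in auto)
    then show ?thesis using R_carrier[of j] transfer_carrier[of i j] s j 1(3) assms
      by (simp add: state_Suc transfer_Suc mat_mult_assoc)
  qed
qed

text \<open>The new \<open>Q1\<close> always meets a factor \<open>(Q 1)\<^sup>T * D\<close> on its
  left, and by the first assumption the product collapses to the old \<open>(Q 1)\<^sup>T\<close>.
  In the state for \<open>l = 1\<close>, \<open>k = 2\<close> this factor is missing, since there it
  sits in \<open>P 2\<close>; hence the exclusion.\<close>

lemma state_update:
  assumes QD: "(Q 1)\<^sup>T * D * Q1\<^sup>T = (Q 1)\<^sup>T" and D: "D \<in> carrier_mat (N 1) s" and Q1: "Q1 \<in> carrier_mat (N 1) s"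
    and "1 \<le> l" "l < k" "k \<le> n" "\<not> (l = 1 \<and> k = 2)"
  shows "state (R(2 := R 2 * (Q 1)\<^sup>T * D)) (Q(1 := Q1)) k l = state R Q k l"
  using assms(5-)
proof (induction k rule: nat_less_induct)
  case (1 k)
  let ?R = "R(2 := R 2 * (Q 1)\<^sup>T * D)" and ?Q = "Q(1 := Q1)"
  \<comment> \<open>Only \<open>k = 3\<close> with \<open>l = 1\<close> sees the collapse, through
    \<open>R 2\<close>. For \<open>k = Suc l\<close> the state is an unchanged \<open>Q l\<close>,
    and otherwise the last factor is an unchanged \<open>R j\<close>.\<close>
  consider "k = Suc l" | "l = 1" "k = 3" | j where "k = Suc j" "l < j" "\<not> (l = 1 \<and> j = 2)" "j \<noteq> 2"
    using 1(2,4) \<open>1 \<le> l\<close> by (cases k) force+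
  then show ?case
  proof cases
    case 1
    then show ?thesis using \<open>\<not> (l = 1 \<and> k = 2)\<close> by simp
  next
    case 2
    have Q: "Q 1 \<in> carrier_mat (N 1) (r 1)" "R 2 \<in> carrier_mat (r 2) (r 1)"
      using Q_carrier[of 1] R_carrier[of 2] 2 1(3) by auto
    have "state ?R ?Q (Suc (Suc 1)) 1 = R 2 * (Q 1)\<^sup>T * D * Q1\<^sup>T"
      by (subst state_Suc) (auto simp: numeral_2_eq_2)
    also have "\<dots> = R 2 * (Q 1)\<^sup>T" using QD Q D Q1 by (simp add: mat_mult_assoc)
    also have "\<dots> = state R Q (Suc (Suc 1)) 1"
      by (subst state_Suc) (auto simp: numeral_2_eq_2)
    finally show ?thesis using 2 by (simp add: numeral_3_eq_3 del: fun_upd_apply)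
  next
    case 3
    have "state ?R ?Q j l = state R Q j l"
      by (rule 1(1)[rule_format]) (use 3 1(3) in auto)
    then show ?thesis using 3 by (simp add: state_Suc fun_upd_other del: fun_upd_apply)
  qed
qed

text \<open>The excluded case \<open>k = 2\<close> is now covered as well, because the changed
  \<open>P 2\<close> supplies the factor that \<open>R 2\<close> supplies for larger
  \<open>k\<close>.\<close>

lemma chain_update:
  assumes QD: "(Q 1)\<^sup>T * D * Q1\<^sup>T = (Q 1)\<^sup>T" and D: "D \<in> carrier_mat (N 1) s" and Q1: "Q1 \<in> carrier_mat (N 1) s"
    and kl: "1 \<le> l" "l < k" "k \<le> n"
  shows "(P(2 := P 2 * (Q 1)\<^sup>T * D)) k * state (R(2 := R 2 * (Q 1)\<^sup>T * D)) (Q(1 := Q1)) k l = P k * state R Q k l"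
proof (cases "k = 2")
  case True
  then have "l = 1" using kl by auto
  have "Q 1 \<in> carrier_mat (N 1) (r 1)" "P 2 \<in> carrier_mat (N 2) (r 1)"
    using Q_carrier[of 1] P_carrier[of 2] True kl by auto
  then have "P 2 * (Q 1)\<^sup>T * D * Q1\<^sup>T = P 2 * (Q 1)\<^sup>T" using QD D Q1 by (simp add: mat_mult_assoc)
  then show ?thesis using True \<open>l = 1\<close> state_Suc_self[of _ _ 1] by (simp add: numeral_2_eq_2)
next
  case False
  then show ?thesis using state_update[OF QD D Q1 kl] by simp
qed

end

lemma generators_update:
  assumes g: "generators n N r P R Q" and n: "n \<ge> 3"
    and D: "D \<in> carrier_mat (N 1) s" and Q1: "Q1 \<in> carrier_mat (N 1) s"
  shows "generators n N (r(1 := s)) (P(2 := P 2 * (Q 1)\<^sup>T * D)) (R(2 := R 2 * (Q 1)\<^sup>T * D)) (Q(1 := Q1))"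
proof -
  have "Q 1 \<in> carrier_mat (N 1) (r 1)" "P 2 \<in> carrier_mat (N 2) (r 1)" "R 2 \<in> carrier_mat (r 2) (r 1)"
    using Q_carrier[OF g, of 1] P_carrier[OF g, of 2] R_carrier[OF g, of 2] n by auto
  then show ?thesis using g D Q1 unfolding generators_def by auto
qed

lemma append_rows_mult:
  fixes A B C :: "real mat"
  assumes A: "A \<in> carrier_mat a s" and B: "B \<in> carrier_mat b s" and C: "C \<in> carrier_mat s c"
  shows "(A * C) @\<^sub>r (B * C) = (A @\<^sub>r B) * C"
proof (rule eq_matI)
  have d: "dim_row A = a" "dim_col A = s" "dim_row B = b" "dim_col B = s" "dim_row C = s" "dim_col C = c"
    using A B C by auto
  fix i j assume "i < dim_row ((A @\<^sub>r B) * C)" "j < dim_col ((A @\<^sub>r B) * C)"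
  then have ij: "i < a + b" "j < c" using d by (auto simp: append_rows_def)
  show "((A * C) @\<^sub>r (B * C)) $$ (i, j) = ((A @\<^sub>r B) * C) $$ (i, j)"
  proof (cases "i < a")
    case True
    have "row (A @\<^sub>r B) i = row A i"
      by (rule eq_vecI) (use True d ij in \<open>auto simp: append_rows_def row_def\<close>)
    then show ?thesis using True ij d by (auto simp: append_rows_def)
  next
    case False
    have "row (A @\<^sub>r B) i = row B (i - a)"
      by (rule eq_vecI) (use False d ij in \<open>auto simp: append_rows_def row_def\<close>)
    then show ?thesis using False ij d by (auto simp: append_rows_def)
  qed
qed (use A B C in \<open>auto simp: append_rows_def\<close>)

section \<open>Abstract block selectors and projections, and the rank arguments over them\<close>

text \<open>\<open>E k\<close> selects the rows of block \<open>k\<close>, and \<open>Pi K\<close> is the coordinate projection onto the blocks in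
  \<open>K\<close>, so the rank of a block submatrix is the rank of \<open>Pi I * M * Pi J\<close>. The axioms are invariant under
  numbering the blocks backwards, which exchanges the lower and the upper triangular part.\<close>

locale block_frame =
  fixes n :: nat and N :: "nat \<Rightarrow> nat" and T :: nat
    and E :: "nat \<Rightarrow> real mat" and Pi :: "nat set \<Rightarrow> real mat"
  assumes E_carrier: "k \<in> {1..n} \<Longrightarrow> E k \<in> carrier_mat (N k) T"
    and Pi_carrier: "Pi K \<in> carrier_mat T T"
    and Pi_transpose: "(Pi K)\<^sup>T = Pi K"
    and Pi_mult: "Pi K * Pi L = Pi (K \<inter> L)"
    and E_Pi: "k \<in> {1..n} \<Longrightarrow> E k * Pi K = (if k \<in> K then E k else 0\<^sub>m (N k) T)"
    and Pi_ext: "A \<in> carrier_mat T c \<Longrightarrow> B \<in> carrier_mat T c \<Longrightarrow> K \<subseteq> {1..n} \<Longrightarrow>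
      (\<And>k. k \<in> K \<Longrightarrow> E k * A = E k * B) \<Longrightarrow> Pi K * A = Pi K * B"
    and stack: "(\<And>k. k \<in> {1..n} \<Longrightarrow> X k \<in> carrier_mat (N k) c) \<Longrightarrow>
      \<exists>S \<in> carrier_mat T c. \<forall>k \<in> {1..n}. E k * S = X k"
begin

lemma E_dim [simp]: "1 \<le> k \<Longrightarrow> k \<le> n \<Longrightarrow> dim_row (E k) = N k" "1 \<le> k \<Longrightarrow> k \<le> n \<Longrightarrow> dim_col (E k) = T"
  using E_carrier[of k] by auto

lemma Pi_dim [simp]: "dim_row (Pi K) = T" "dim_col (Pi K) = T"
  using Pi_carrier[of K] by auto

lemma Pi_E: "k \<in> {1..n} \<Longrightarrow> k \<in> K \<Longrightarrow> Pi K * (E k)\<^sup>T = (E k)\<^sup>T"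
  using E_Pi[of k K] transpose_mult[of "E k" "N k" T "Pi K" T] E_carrier[of k] Pi_carrier[of K]
  by (simp add: Pi_transpose)

lemma stack_on:
  assumes "K \<subseteq> {1..n}" "\<And>k. k \<in> K \<Longrightarrow> X k \<in> carrier_mat (N k) c"
  obtains S where "S \<in> carrier_mat T c" "\<And>k. k \<in> K \<Longrightarrow> E k * S = X k"
proof -
  have "\<exists>S \<in> carrier_mat T c. \<forall>k \<in> {1..n}. E k * S = (if k \<in> K then X k else 0\<^sub>m (N k) c)"
    by (rule stack) (use assms in auto)
  then show ?thesis using that assms(1) by (metis subsetD)
qed

text \<open>\<open>Pi_ext\<close> compares block rows only. Block columns are compared by
  transposing, which \<open>Pi\<close> survives since it is symmetric.\<close>

lemma Pi_ext2:
  assumes A: "A \<in> carrier_mat T T" and B: "B \<in> carrier_mat T T" and KL: "K \<subseteq> {1..n}" "L \<subseteq> {1..n}"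
    and eq: "\<And>k l. k \<in> K \<Longrightarrow> l \<in> L \<Longrightarrow> E k * A * (E l)\<^sup>T = E k * B * (E l)\<^sup>T"
  shows "Pi K * A * Pi L = Pi K * B * Pi L"
proof -
  have "E k * (A * Pi L) = E k * (B * Pi L)" if k: "k \<in> K" for k
  proof -
    have kc: "E k \<in> carrier_mat (N k) T" using k KL E_carrier by auto
    have t: "(E k * C * Pi L)\<^sup>T = Pi L * (E k * C)\<^sup>T" if "C \<in> carrier_mat T T" for C
      using that kc Pi_carrier[of L] by (subst transpose_mult[of "E k * C" "N k" T "Pi L" T]) (auto simp: Pi_transpose)
    have tl: "E l * (E k * C)\<^sup>T = (E k * C * (E l)\<^sup>T)\<^sup>T" if "C \<in> carrier_mat T T" "l \<in> L" for C l
      using that kc E_carrier[of l] KL by (subst transpose_mult[of _ "N k" T _ "N l"]) auto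
    have "Pi L * (E k * A)\<^sup>T = Pi L * (E k * B)\<^sup>T"
      by (rule Pi_ext[of _ "N k"]) (use A B KL kc eq k in \<open>auto simp: tl\<close>)
    then have "(E k * A * Pi L)\<^sup>T = (E k * B * Pi L)\<^sup>T" using A B by (simp add: t)
    then have "E k * A * Pi L = E k * B * Pi L" using transpose_mat_eq by blast
    then show ?thesis using A B kc by (simp add: mat_mult_assoc)
  qed
  then have "Pi K * (A * Pi L) = Pi K * (B * Pi L)"
    by (intro Pi_ext[of _ T]) (use A B KL Pi_carrier[of L] in auto)
  then show ?thesis using A B by (simp add: mat_mult_assoc)
qed

text \<open>The observability and controllability factorization of a Hankel block: \<open>S\<close>
  stacks \<open>P k * transfer r R k i\<close> over the rows below \<open>i\<close>, and
  \<open>C\<close> lines up the states of the columns up to \<open>i\<close>. The last conclusion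
  keeps a single block column, which for \<open>i = 1\<close> isolates the transposed
  \<open>Q 1\<close>.\<close>

lemma factor_of_chain:
  assumes g: "generators n N r P R Q" and M: "M \<in> carrier_mat T T" and i: "1 \<le> i" "i < n"
    and eq: "\<And>k l. 1 \<le> l \<Longrightarrow> l \<le> i \<Longrightarrow> i < k \<Longrightarrow> k \<le> n \<Longrightarrow> E k * M * (E l)\<^sup>T = P k * state R Q k l"
  obtains S C where "S \<in> carrier_mat T (r i)" "C \<in> carrier_mat (r i) T"
    "\<And>l. 1 \<le> l \<Longrightarrow> l \<le> i \<Longrightarrow> C * (E l)\<^sup>T = state R Q (Suc i) l"
    "Pi {i+1..n} * M * Pi {1..i} = Pi {i+1..n} * S * C * Pi {1..i}"
    "\<And>l. 1 \<le> l \<Longrightarrow> l \<le> i \<Longrightarrow> Pi {i+1..n} * M * (E l)\<^sup>T = Pi {i+1..n} * S * state R Q (Suc i) l"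
proof -
  have PT: "P k \<in> carrier_mat (N k) (r (k-1))" "transfer r R k i \<in> carrier_mat (r (k-1)) (r i)"
    if "k \<in> {i+1..n}" for k
    using P_carrier[OF g] transfer_carrier[OF g] i that by auto
  obtain S where S: "S \<in> carrier_mat T (r i)" "\<And>k. k \<in> {i+1..n} \<Longrightarrow> E k * S = P k * transfer r R k i"
    by (rule stack_on[of "{i+1..n}" "\<lambda>k. P k * transfer r R k i" "r i"]) (use PT i in \<open>auto intro!: mult_carrier_mat\<close>)
  have st: "state R Q (Suc i) l \<in> carrier_mat (r i) (N l)" if "l \<in> {1..i}" for l
    using state_carrier[OF g, of l "Suc i"] that i by auto
  obtain C0 where C0: "C0 \<in> carrier_mat T (r i)" "\<And>l. l \<in> {1..i} \<Longrightarrow> E l * C0 = (state R Q (Suc i) l)\<^sup>T"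
    by (rule stack_on[of "{1..i}" "\<lambda>l. (state R Q (Suc i) l)\<^sup>T" "r i"]) (use st i in auto)
  define C where "C = C0\<^sup>T"
  have C: "C \<in> carrier_mat (r i) T" using C0 by (simp add: C_def)
  have CE: "C * (E l)\<^sup>T = state R Q (Suc i) l" if "l \<in> {1..i}" for l
    using transpose_mult[of "E l" "N l" T C0 "r i"] C0 that E_carrier[of l] i by (simp add: C_def)
  have blk: "E k * M * (E l)\<^sup>T = E k * (S * C) * (E l)\<^sup>T" if k: "k \<in> {i+1..n}" and l: "l \<in> {1..i}" for k l
  proof -
    have "E k * (S * C) * (E l)\<^sup>T = (E k * S) * (C * (E l)\<^sup>T)"
      using E_carrier[of k] E_carrier[of l] S(1) C k l i by (simp add: mat_mult_assoc)
    also have "\<dots> = P k * (transfer r R k i * state R Q (Suc i) l)"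
      using S(2)[OF k] CE[OF l] PT[OF k] st[OF l] by (simp add: mat_mult_assoc)
    also have "\<dots> = P k * state R Q k l" using state_transfer[OF g, of l i k] k l by auto
    finally show ?thesis using eq[of l k] k l by auto
  qed
  show ?thesis
  proof (rule that[of S C])
    have "Pi {i+1..n} * M * Pi {1..i} = Pi {i+1..n} * (S * C) * Pi {1..i}"
      by (rule Pi_ext2) (use M S C i blk in auto)
    then show "Pi {i+1..n} * M * Pi {1..i} = Pi {i+1..n} * S * C * Pi {1..i}"
      using S C by (simp add: mat_mult_assoc)
    show "Pi {i+1..n} * M * (E l)\<^sup>T = Pi {i+1..n} * S * state R Q (Suc i) l" if "1 \<le> l" "l \<le> i" for l
    proof -
      have l: "l \<in> {1..i}" "E l \<in> carrier_mat (N l) T" using that i E_carrier[of l] by auto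
      have "Pi {i+1..n} * (M * (E l)\<^sup>T) = Pi {i+1..n} * (S * C * (E l)\<^sup>T)"
      proof (rule Pi_ext[of _ "N l"])
        fix k assume k: "k \<in> {i+1..n}"
        then show "E k * (M * (E l)\<^sup>T) = E k * (S * C * (E l)\<^sup>T)"
          using blk[OF k l(1)] M S C l E_carrier[of k] i by (simp add: mat_mult_assoc)
      qed (use M S C l i in auto)
      then show ?thesis using CE[OF l(1)] st[OF l(1)] M S C l by (simp add: mat_mult_assoc)
    qed
  qed (use S C CE in auto)
qed

lemma rank_le_generators:
  assumes "generators n N r P R Q" "M \<in> carrier_mat T T" "1 \<le> i" "i < n"
    and "\<And>k l. 1 \<le> l \<Longrightarrow> l \<le> i \<Longrightarrow> i < k \<Longrightarrow> k \<le> n \<Longrightarrow> E k * M * (E l)\<^sup>T = P k * state R Q k l"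
  shows "mat_rank (Pi {i+1..n} * M * Pi {1..i}) \<le> r i"
proof -
  obtain S C where S: "S \<in> carrier_mat T (r i)" and C: "C \<in> carrier_mat (r i) T"
    and eq: "Pi {i+1..n} * M * Pi {1..i} = Pi {i+1..n} * S * C * Pi {1..i}"
    by (rule factor_of_chain[OF assms(1-4)]) (use assms(5) in auto)
  have "mat_rank ((Pi {i+1..n} * S) * (C * Pi {1..i})) \<le> r i"
    by (rule mat_rank_mult_le[of _ T _ _ T]; rule carrier_matI) (use S C in simp_all)
  moreover have "Pi {i+1..n} * S * C * Pi {1..i} = (Pi {i+1..n} * S) * (C * Pi {1..i})"
    using S C by (simp add: mat_mult_assoc)
  ultimately show ?thesis using eq by simp
qed

text \<open>A Ho-Kalman style realization. Each Hankel block \<open>G i\<close> is factored as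
  \<open>S i * C i\<close> with inner dimension its rank, so \<open>S i\<close> has a left inverse
  \<open>L i\<close>. Neighbouring Hankel blocks agree where they overlap, and this makes one set of
  generators serve all of them.\<close>

lemma minimal_generators_exist:
  assumes M: "M \<in> carrier_mat T T"
  defines "r \<equiv> \<lambda>i. mat_rank (Pi {i+1..n} * M * Pi {1..i})"
  shows "\<exists>P R Q. generators n N r P R Q \<and>
    (\<forall>k l. 1 \<le> l \<longrightarrow> l < k \<longrightarrow> k \<le> n \<longrightarrow> E k * M * (E l)\<^sup>T = P k * state R Q k l)"
proof -
  define G where "G i = Pi {i+1..n} * M * Pi {1..i}" for i
  have G: "G i \<in> carrier_mat T T" for i unfolding G_def using M by auto
  have "\<exists>S C L. S \<in> carrier_mat T (r i) \<and> C \<in> carrier_mat (r i) T \<and> L \<in> carrier_mat (r i) T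
      \<and> S * C = G i \<and> L * S = 1\<^sub>m (r i)" for i
  proof -
    obtain S C where SC: "S \<in> carrier_mat T (r i)" "C \<in> carrier_mat (r i) T" "G i = S * C"
      using factor_through_rank[OF G[of i]] unfolding r_def G_def by blast
    have "mat_rank S = r i"
      using mat_rank_mult_right_le[OF SC(1,2)] mat_rank_le_dims(2)[OF SC(1)] SC(3)
      by (simp add: r_def G_def)
    then obtain L where "L \<in> carrier_mat (r i) T" "L * S = 1\<^sub>m (r i)"
      using full_col_rank_left_inverse[OF SC(1)] by auto
    then show ?thesis using SC(1,2) SC(3)[symmetric] by blast
  qed
  then obtain S C L where S: "\<And>i. S i \<in> carrier_mat T (r i)" and C: "\<And>i. C i \<in> carrier_mat (r i) T"
    and L: "\<And>i. L i \<in> carrier_mat (r i) T" and SC: "\<And>i. S i * C i = G i" and LS: "\<And>i. L i * S i = 1\<^sub>m (r i)"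
    by metis
  \<comment> \<open>\<open>P k\<close> and \<open>Q i\<close> are read off the factors.
    \<open>R i\<close> is chosen so that it maps the columns of \<open>C (i-1)\<close> to those of
    \<open>C i\<close> on the blocks before \<open>i\<close>.\<close>
  define P R Q where "P k = E k * S (k-1)" and "R i = L i * Pi {i+1..n} * S (i-1)" and "Q i = E i * (C i)\<^sup>T"
    for k i :: nat
  have g: "generators n N r P R Q" unfolding generators_def P_def R_def Q_def
    using carrier_matD[OF S] carrier_matD[OF C] carrier_matD[OF L] by (auto intro!: carrier_matI)
  have dims [simp]: "dim_row M = T" "dim_col M = T" "dim_row (G i) = T" "dim_col (G i) = T"
    "dim_row (S i) = T" "dim_col (S i) = r i" "dim_row (C i) = r i" "dim_col (C i) = T"
    "dim_row (L i) = r i" "dim_col (L i) = T" for i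
    using M G[of i] S[of i] C[of i] L[of i] by auto
  \<comment> \<open>\<open>G i\<close> agrees with \<open>M\<close> on block rows below
    \<open>i\<close> and block columns up to \<open>i\<close>; \<open>K\<close> is left free so that
    \<open>G k\<close> and \<open>G (Suc k)\<close> can be compared on their common rows.\<close>
  have GE: "Pi K * G i * (E l)\<^sup>T = Pi K * M * (E l)\<^sup>T"
    if "K \<subseteq> {i+1..n}" "1 \<le> l" "l \<le> i" "i < n" for K i l
  proof -
    have "Pi K * G i * (E l)\<^sup>T = (Pi K * Pi {i+1..n}) * M * (Pi {1..i} * (E l)\<^sup>T)"
      using that by (simp add: G_def mat_mult_assoc)
    also have "\<dots> = Pi K * M * (E l)\<^sup>T" using that by (simp add: Pi_mult Pi_E Int_absorb2)
    finally show ?thesis .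
  qed
  \<comment> \<open>The states are the block columns of \<open>C k\<close>. In the induction step
    \<open>G k\<close> is replaced by \<open>M\<close> and then by \<open>G (Suc k)\<close> on the
    rows below \<open>Suc k\<close>, after which \<open>L (Suc k)\<close> cancels
    \<open>S (Suc k)\<close>.\<close>
  have st: "state R Q (Suc k) l = C k * (E l)\<^sup>T" if "1 \<le> l" "l \<le> k" "k < n" for k l
    using that(2,3)
  proof (induction k rule: dec_induct)
    case base
    then show ?case using transpose_mult[of "E l" "N l" T "(C l)\<^sup>T" "r l"] C[of l] E_carrier[of l] that(1)
      by (simp add: Q_def)
  next
    case (step k)
    then have IH: "state R Q (Suc k) l = C k * (E l)\<^sup>T" by auto
    let ?p = "Pi {Suc k+1..n}"
    have l: "dim_col (E l) = T" using step that by auto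
    have "state R Q (Suc (Suc k)) l = L (Suc k) * ?p * S k * (C k * (E l)\<^sup>T)"
      using step IH by (simp add: state_Suc R_def)
    also have "\<dots> = L (Suc k) * (?p * (S k * C k) * (E l)\<^sup>T)" using l by (simp add: mat_mult_assoc)
    also have "?p * (S k * C k) * (E l)\<^sup>T = ?p * M * (E l)\<^sup>T"
      unfolding SC by (rule GE) (use step that in auto)
    also have "\<dots> = ?p * G (Suc k) * (E l)\<^sup>T"
      by (rule GE[symmetric]) (use step that in auto)
    also have "?p * G (Suc k) = (?p * ?p) * M * Pi {1..Suc k}" unfolding G_def by (simp add: mat_mult_assoc)
    also have "\<dots> = S (Suc k) * C (Suc k)" by (simp add: Pi_mult SC) (simp add: G_def)
    also have "L (Suc k) * (S (Suc k) * C (Suc k) * (E l)\<^sup>T) = (L (Suc k) * S (Suc k)) * (C (Suc k) * (E l)\<^sup>T)"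
      using l by (simp add: mat_mult_assoc)
    also have "\<dots> = C (Suc k) * (E l)\<^sup>T" using C[of "Suc k"] l by (simp add: LS)
    finally show ?case .
  qed
  have "E k * M * (E l)\<^sup>T = P k * state R Q k l" if kl: "1 \<le> l" "l < k" "k \<le> n" for k l
  proof -
    obtain j where j: "k = Suc j" using kl by (cases k) auto
    have "P k * state R Q k l = E k * (S j * C j) * (E l)\<^sup>T"
      using st[of l j] j kl by (simp add: P_def mat_mult_assoc)
    also have "\<dots> = E k * Pi {k..n} * G j * (E l)\<^sup>T" using kl by (simp add: SC E_Pi)
    also have "\<dots> = E k * (Pi {k..n} * G j * (E l)\<^sup>T)" using kl by (simp add: mat_mult_assoc)
    also have "\<dots> = E k * (Pi {k..n} * M * (E l)\<^sup>T)" by (subst GE) (use j kl in auto)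
    also have "\<dots> = E k * Pi {k..n} * M * (E l)\<^sup>T" using kl by (simp add: mat_mult_assoc)
    finally show ?thesis using kl by (simp add: E_Pi)
  qed
  then show ?thesis using g by blast
qed

text \<open>\<open>M\<close> stands for the matrix with the optimal corner and \<open>M0\<close> for
  the one with corner 0. Passing to \<open>M0\<close> amounts to deleting the last block row of the
  first block column; by optimality this does not lower the rank, so the deleted row is a
  combination of those that remain.\<close>

lemma corner_factors:
  assumes n: "n \<ge> 2" and M: "M \<in> carrier_mat T T" and M0: "M0 \<in> carrier_mat T T"
    and eq0: "\<And>k. 2 \<le> k \<Longrightarrow> k < n \<Longrightarrow> E k * M0 * (E 1)\<^sup>T = E k * M * (E 1)\<^sup>T"
    and z0: "E n * M0 * (E 1)\<^sup>T = 0\<^sub>m (N n) (N 1)"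
    and rk: "mat_rank (Pi {2..n} * M * Pi {1}) \<le> mat_rank (Pi {2..n} * M0 * Pi {1})"
  shows "\<exists>K \<in> carrier_mat (N n) T. E n * M * (E 1)\<^sup>T = K * (Pi {2..n-1} * M * (E 1)\<^sup>T)"
proof -
  define G where "G = Pi {2..n} * M * Pi {1}"
  have G: "G \<in> carrier_mat T T" unfolding G_def using M by auto
  define r where "r = mat_rank G"
  obtain S C where S: "S \<in> carrier_mat T r" and C: "C \<in> carrier_mat r T" and SC: "S * C = G"
    using factor_through_rank[OF G] unfolding r_def by metis
  let ?p = "Pi {2..n-1}"
  have dims [simp]: "dim_row M = T" "dim_col M = T" "dim_row G = T" "dim_col G = T"
    "dim_row S = T" "dim_col S = r" "dim_row C = r" "dim_col C = T" "dim_row M0 = T" "dim_col M0 = T"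
    using M M0 G S C by auto
  have pG: "?p * G = ?p * M * Pi {1}"
  proof -
    have "?p * G = (?p * Pi {2..n}) * M * Pi {1}" unfolding G_def by (simp add: mat_mult_assoc)
    also have "?p * Pi {2..n} = ?p" using Pi_mult[of "{2..n-1}" "{2..n}"] by (simp add: Int_absorb2)
    finally show ?thesis .
  qed
  \<comment> \<open>The zero corner makes the first block column of \<open>M0\<close> that of
    \<open>M\<close> with block row \<open>n\<close> projected away.\<close>
  have "Pi {2..n} * M0 * Pi {1} = Pi {2..n} * (?p * M) * Pi {1}"
  proof (rule Pi_ext2)
    fix k l :: nat assume k: "k \<in> {2..n}" and l: "l \<in> {1}"
    have "E k * (?p * M) * (E l)\<^sup>T = (E k * ?p) * M * (E l)\<^sup>T" using k l n by (simp add: mat_mult_assoc)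
    also have "\<dots> = E k * M0 * (E l)\<^sup>T"
    proof (cases "k = n")
      case True
      have "0\<^sub>m (N n) T * M * (E 1)\<^sup>T = 0\<^sub>m (N n) (N 1)" using n left_mult_zero_mat[of "M" T T "N n"]
          left_mult_zero_mat[of "(E 1)\<^sup>T" T "N 1" "N n"] M E_carrier[of 1] by auto
      moreover have "n \<notin> {2..n-1}" using n by auto
      ultimately show ?thesis using True k l z0 n by (simp add: E_Pi)
    next
      case False
      then have "E k * ?p = E k" using k n by (subst E_Pi) auto
      then show ?thesis using False k l eq0[of k] by simp
    qed
    finally show "E k * M0 * (E l)\<^sup>T = E k * (?p * M) * (E l)\<^sup>T" ..
  qed (use M M0 n in \<open>auto intro!: carrier_matI\<close>)
  also have "\<dots> = (Pi {2..n} * ?p) * M * Pi {1}" by (simp add: mat_mult_assoc)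
  also have "Pi {2..n} * ?p = ?p" using Pi_mult[of "{2..n}" "{2..n-1}"] by (simp add: Int_absorb1)
  also have "?p * M * Pi {1} = ?p * (S * C)" unfolding SC by (rule pG[symmetric])
  also have "\<dots> = ?p * S * C" by (simp add: mat_mult_assoc)
  finally have M0_eq: "Pi {2..n} * M0 * Pi {1} = ?p * S * C" .
  have pS: "?p * S \<in> carrier_mat T r" by (rule mult_carrier_mat[OF Pi_carrier S])
  \<comment> \<open>The rank comparison enters here: even without the rows of block
    \<open>n\<close>, the factor \<open>S\<close> keeps full column rank and so has a left
    inverse.\<close>
  have "r \<le> mat_rank (?p * S * C)" using rk unfolding M0_eq by (simp only: r_def G_def)
  also have "\<dots> \<le> mat_rank (?p * S)" by (rule mat_rank_mult_right_le[OF pS C])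
  finally have "mat_rank (?p * S) = r" using mat_rank_le_dims(2)[OF pS] by (metis order_antisym)
  then obtain L where L: "L \<in> carrier_mat r T" "L * (?p * S) = 1\<^sub>m r"
    using full_col_rank_left_inverse[OF pS] by auto
  have d [simp]: "dim_row L = r" "dim_col L = T" "dim_col (E 1) = T" "dim_row (E n) = N n" "dim_col (E n) = T"
    using L n by auto
  have GE: "G * (E 1)\<^sup>T = Pi {2..n} * M * (E 1)\<^sup>T" using Pi_E[of 1 "{1}"] n by (simp add: G_def mat_mult_assoc)
  have "E n * M * (E 1)\<^sup>T = (E n * Pi {2..n}) * M * (E 1)\<^sup>T" using n by (simp add: E_Pi)
  also have "\<dots> = E n * (G * (E 1)\<^sup>T)" using n unfolding GE by (simp add: mat_mult_assoc)
  \<comment> \<open>The identity is inserted in order to be replaced by \<open>L * (?p * S)\<close>,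
    which expresses the last block row through the middle ones.\<close>
  also have "\<dots> = E n * S * (1\<^sub>m r * C) * (E 1)\<^sup>T" using C n by (simp add: mat_mult_assoc flip: SC)
  also have "\<dots> = E n * S * (L * (?p * S) * C) * (E 1)\<^sup>T" unfolding L(2) ..
  also have "\<dots> = E n * S * L * (?p * G * (E 1)\<^sup>T)" unfolding SC[symmetric] using n by (simp add: mat_mult_assoc)
  also have "?p * G * (E 1)\<^sup>T = ?p * M * (E 1)\<^sup>T" unfolding pG using n Pi_E[of 1 "{1}"] by (simp add: mat_mult_assoc)
  finally show ?thesis using n by (intro bexI[of _ "E n * S * L"]) auto
qed

text \<open>Here \<open>C\<close> plays the transposed \<open>Q 1\<close> of a competing CSS
  representation and \<open>g' k * C\<close> its block \<open>(k,1)\<close>. For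
  \<open>k = n\<close> that block is A_n1 while \<open>M\<close> carries \<open>X\<close>, so
  \<open>g_eq\<close> stops before \<open>n\<close>. Both halves of the stacked matrix are shown to
  be left multiples of \<open>C\<close>, which has \<open>s\<close> rows.\<close>

lemma corner_rank_le:
  assumes n: "n \<ge> 3" and g: "generators n N r P R Q" and M: "M \<in> carrier_mat T T"
    and eq: "\<And>k. 1 < k \<Longrightarrow> k \<le> n \<Longrightarrow> E k * M * (E 1)\<^sup>T = P k * state R Q k 1"
    and r1: "r 1 = mat_rank (Pi {2..n} * M * Pi {1})"
    and M0: "M0 \<in> carrier_mat T T"
    and eq0: "\<And>k. 2 \<le> k \<Longrightarrow> k < n \<Longrightarrow> E k * M0 * (E 1)\<^sup>T = E k * M * (E 1)\<^sup>T"
    and z0: "E n * M0 * (E 1)\<^sup>T = 0\<^sub>m (N n) (N 1)"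
    and rk: "mat_rank (Pi {2..n} * M * Pi {1}) \<le> mat_rank (Pi {2..n} * M0 * Pi {1})"
    and C: "C \<in> carrier_mat s (N 1)"
    and g_carrier: "\<And>k. 2 \<le> k \<Longrightarrow> k \<le> n \<Longrightarrow> g' k \<in> carrier_mat (N k) s"
    and g_eq: "\<And>k. 2 \<le> k \<Longrightarrow> k < n \<Longrightarrow> E k * M * (E 1)\<^sup>T = g' k * C"
    and X: "X = E n * M * (E 1)\<^sup>T"
  shows "mat_rank ((Q 1)\<^sup>T @\<^sub>r (g' n * C - X)) \<le> s"
proof -
  have E1: "E 1 \<in> carrier_mat (N 1) T" using E_carrier n by auto
  have dims [simp]: "dim_row M = T" "dim_col M = T" "dim_row C = s" "dim_col C = N 1"
    using M C by auto
  have factor: "Pi K * M * (E 1)\<^sup>T = Pi K * S * C"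
    if S: "S \<in> carrier_mat T s" and K: "K \<subseteq> {1..n}" and e: "\<And>k. k \<in> K \<Longrightarrow> E k * M * (E 1)\<^sup>T = E k * S * C" for K S
  proof -
    have "Pi K * (M * (E 1)\<^sup>T) = Pi K * (S * C)"
    proof (rule Pi_ext[of _ "N 1"])
      fix k assume k: "k \<in> K"
      then show "E k * (M * (E 1)\<^sup>T) = E k * (S * C)" using e[OF k] S K n E1 by (auto simp: mat_mult_assoc subset_iff)
    qed (use M S C K E1 n in auto)
    then show ?thesis using S n by (simp add: mat_mult_assoc)
  qed
  obtain K where K: "K \<in> carrier_mat (N n) T" "X = K * (Pi {2..n-1} * M * (E 1)\<^sup>T)"
    using corner_factors[OF _ M M0 eq0 z0 rk] n X by auto
  obtain S1 where S1: "S1 \<in> carrier_mat T s" "\<And>k. k \<in> {2..n-1} \<Longrightarrow> E k * S1 = g' k"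
    by (rule stack_on[of "{2..n-1}" g' s]) (use g_carrier in auto)
  have "Pi {2..n-1} * M * (E 1)\<^sup>T = Pi {2..n-1} * S1 * C"
    by (rule factor[OF S1(1)]) (use S1(2) g_eq in auto)
  \<comment> \<open>\<open>X\<close> is a combination of the middle blocks, and these factor through
    \<open>C\<close>; hence \<open>X\<close> does too.\<close>
  then have XC: "X = K * (Pi {2..n-1} * S1) * C" using K S1(1) by (simp add: mat_mult_assoc)
  define gX where "gX = K * (Pi {2..n-1} * S1)"
  have gX: "gX \<in> carrier_mat (N n) s" unfolding gX_def using K S1 Pi_carrier by (auto intro!: mult_carrier_mat)
  obtain S2 where S2: "S2 \<in> carrier_mat T s" "\<And>k. k \<in> {2..n} \<Longrightarrow> E k * S2 = (if k = n then gX else g' k)"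
    by (rule stack_on[of "{2..n}" "\<lambda>k. if k = n then gX else g' k" s]) (use g_carrier gX in auto)
  have PM: "Pi {2..n} * M * (E 1)\<^sup>T = Pi {2..n} * S2 * C"
    by (rule factor[OF S2(1)]) (use S2(2) g_eq X XC in \<open>auto simp: gX_def\<close>)
  obtain S D where S: "S \<in> carrier_mat T (r 1)" and D: "D \<in> carrier_mat (r 1) T"
    and e1: "Pi {1+1..n} * M * Pi {1..1} = Pi {1+1..n} * S * D * Pi {1..1}"
    and e2: "\<And>l. 1 \<le> l \<Longrightarrow> l \<le> 1 \<Longrightarrow> Pi {1+1..n} * M * (E l)\<^sup>T = Pi {1+1..n} * S * state R Q (Suc 1) l"
  proof (rule factor_of_chain[OF g M, of 1])
    show "E k * M * (E l)\<^sup>T = P k * state R Q k l" if "1 \<le> l" "l \<le> 1" "1 < k" "k \<le> n" for k l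
      using eq[of k] that by (cases "l = 1") auto
  qed (use n in auto)
  have two: "(1::nat) + 1 = 2" by simp
  let ?S = "Pi {2..n} * S"
  have "Pi {2..n} * S * D * Pi {1} = ?S * (D * Pi {1})" using S D by (simp add: mat_mult_assoc)
  then have "r 1 = mat_rank (?S * (D * Pi {1}))" using e1[unfolded two atLeastAtMost_singleton] r1 by simp
  also have "\<dots> \<le> mat_rank ?S" by (rule mat_rank_mult_right_le[of _ T "r 1" _ T]) (use S D in auto)
  \<comment> \<open>Minimality of the SSS representation is used here: since \<open>r 1\<close> is
    the full rank, \<open>?S\<close> is left invertible and \<open>(Q 1)\<^sup>T\<close> can be
    solved for from the first block column of \<open>M\<close>.\<close>
  finally have "mat_rank ?S = r 1" using mat_rank_le_dims(2)[OF mult_carrier_mat[OF Pi_carrier S]] by (metis order_antisym)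
  then obtain L where L: "L \<in> carrier_mat (r 1) T" "L * ?S = 1\<^sub>m (r 1)"
    using full_col_rank_left_inverse[OF mult_carrier_mat[OF Pi_carrier S]] by auto
  have Q1: "(Q 1)\<^sup>T \<in> carrier_mat (r 1) (N 1)" using Q_carrier[OF g, of 1] n by auto
  have "?S * (Q 1)\<^sup>T = Pi {2..n} * S2 * C" using e2[of 1, unfolded state_Suc_self] PM by (simp add: two del: One_nat_def)
  then have "L * ?S * (Q 1)\<^sup>T = L * (Pi {2..n} * S2) * C" using L(1) S S2 Q1 by (simp add: mat_mult_assoc)
  then have QC: "(Q 1)\<^sup>T = L * (Pi {2..n} * S2) * C" using L(2) Q1 by simp
  let ?Z1 = "L * (Pi {2..n} * S2)" and ?Z2 = "g' n - gX"
  have Z1: "?Z1 \<in> carrier_mat (r 1) s" using L(1) S2(1) Pi_carrier by (auto intro!: mult_carrier_mat)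
  have gn: "g' n \<in> carrier_mat (N n) s" using g_carrier n by auto
  have Z2: "?Z2 \<in> carrier_mat (N n) s" using gX by auto
  have "g' n * C - X = ?Z2 * C" unfolding XC gX_def[symmetric]
    by (rule minus_mult_distrib_mat[OF gn gX C, symmetric])
  then have "(Q 1)\<^sup>T @\<^sub>r (g' n * C - X) = (?Z1 * C) @\<^sub>r (?Z2 * C)" using QC by simp
  also have "\<dots> = (?Z1 @\<^sub>r ?Z2) * C" by (rule append_rows_mult[OF Z1 Z2 C])
  finally show ?thesis using mat_rank_mult_le[OF carrier_append_rows[OF Z1 Z2] C] by simp
qed

text \<open>Reversal is an involution of the blocks 1 to \<open>n\<close>. The intersection with
  \<open>{1..n}\<close> is essential, as truncated subtraction sends every index above
  \<open>n\<close> to 0 and reversal would no longer commute with intersections.\<close>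

lemma block_frame_rev: "block_frame n (\<lambda>k. N (n+1-k)) T (\<lambda>k. E (n+1-k)) (\<lambda>K. Pi ((\<lambda>k. n+1-k) ` (K \<inter> {1..n})))"
proof
  let ?f = "\<lambda>k. n+1-k"
  have inj: "inj_on ?f {1..n}" by (auto intro!: inj_onI)
  fix k assume "k \<in> {1..n}"
  then have k: "?f k \<in> {1..n}" by auto
  then show "E (?f k) \<in> carrier_mat (N (?f k)) T" by (rule E_carrier)
  fix K :: "nat set"
  have "?f k \<in> ?f ` (K \<inter> {1..n}) \<longleftrightarrow> k \<in> K"
    using inj_on_image_mem_iff[OF inj \<open>k \<in> {1..n}\<close>, of "K \<inter> {1..n}"] \<open>k \<in> {1..n}\<close> by simp
  then show "E (?f k) * Pi (?f ` (K \<inter> {1..n})) = (if k \<in> K then E (?f k) else 0\<^sub>m (N (?f k)) T)"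
    using E_Pi[OF k] by simp
next
  let ?f = "\<lambda>k. n+1-k"
  have inj: "inj_on ?f {1..n}" by (auto intro!: inj_onI)
  fix K L :: "nat set"
  show "Pi (?f ` (K \<inter> {1..n})) \<in> carrier_mat T T" by (rule Pi_carrier)
  show "(Pi (?f ` (K \<inter> {1..n})))\<^sup>T = Pi (?f ` (K \<inter> {1..n}))" by (rule Pi_transpose)
  have "?f ` (K \<inter> {1..n}) \<inter> ?f ` (L \<inter> {1..n}) = ?f ` (K \<inter> L \<inter> {1..n})"
    using inj_on_image_Int[OF inj, of "K \<inter> {1..n}" "L \<inter> {1..n}"] by (simp add: Int_ac)
  then show "Pi (?f ` (K \<inter> {1..n})) * Pi (?f ` (L \<inter> {1..n})) = Pi (?f ` (K \<inter> L \<inter> {1..n}))"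
    by (simp add: Pi_mult)
next
  let ?f = "\<lambda>k. n+1-k"
  fix A B :: "real mat" and c K
  assume *: "A \<in> carrier_mat T c" "B \<in> carrier_mat T c" "K \<subseteq> {1..n}" "\<And>k. k \<in> K \<Longrightarrow> E (?f k) * A = E (?f k) * B"
  show "Pi (?f ` (K \<inter> {1..n})) * A = Pi (?f ` (K \<inter> {1..n})) * B"
    by (rule Pi_ext[of _ c]) (use * in auto)
next
  let ?f = "\<lambda>k. n+1-k"
  fix X :: "nat \<Rightarrow> real mat" and c
  assume *: "\<And>k. k \<in> {1..n} \<Longrightarrow> X k \<in> carrier_mat (N (?f k)) c"
  have "\<exists>S\<in>carrier_mat T c. \<forall>k\<in>{1..n}. E k * S = X (?f k)"
  proof (rule stack)
    fix k assume k: "k \<in> {1..n}"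
    then have "?f k \<in> {1..n}" "?f (?f k) = k" by auto
    then show "X (?f k) \<in> carrier_mat (N k) c" using *[of "?f k"] by simp
  qed
  then obtain S where S: "S \<in> carrier_mat T c" "\<forall>k\<in>{1..n}. E k * S = X (?f k)" by blast
  have "E (?f k) * S = X k" if "k \<in> {1..n}" for k
  proof -
    have "?f k \<in> {1..n}" "?f (?f k) = k" using that by auto
    then show ?thesis using S(2) by metis
  qed
  then show "\<exists>S\<in>carrier_mat T c. \<forall>k\<in>{1..n}. E (?f k) * S = X k" using S(1) by blast
qed

end

section \<open>Replacing the corner block\<close>

text \<open>The blocks are given as a function of their position and not as a matrix, so that the
  same predicate covers the upper blocks in reversed numbering.\<close>

definition lower_rep ::
  "nat \<Rightarrow> (nat \<Rightarrow> nat) \<Rightarrow> (nat \<Rightarrow> nat) \<Rightarrow> (nat \<Rightarrow> real mat) \<Rightarrow> (nat \<Rightarrow> real mat) \<Rightarrow> (nat \<Rightarrow> real mat) \<Rightarrow>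
    (nat \<Rightarrow> nat \<Rightarrow> real mat) \<Rightarrow> bool"
where
  "lower_rep n N r P R Q B \<longleftrightarrow> generators n N r P R Q \<and>
     (\<forall>k l. 1 \<le> l \<longrightarrow> l < k \<longrightarrow> k \<le> n \<longrightarrow> B k l = P k * state R Q k l)"

definition lower_css_rep ::
  "nat \<Rightarrow> (nat \<Rightarrow> nat) \<Rightarrow> (nat \<Rightarrow> nat) \<Rightarrow> (nat \<Rightarrow> real mat) \<Rightarrow> (nat \<Rightarrow> real mat) \<Rightarrow> (nat \<Rightarrow> real mat) \<Rightarrow>
    real mat \<Rightarrow> (nat \<Rightarrow> nat \<Rightarrow> real mat) \<Rightarrow> bool"
where
  "lower_css_rep n N r P R Q P0 B \<longleftrightarrow> generators n N r P R Q \<and> P0 \<in> carrier_mat (N n) (r 1) \<and>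
     (\<forall>k l. 1 \<le> l \<longrightarrow> l < k \<longrightarrow> k \<le> n \<longrightarrow> B k l =
        (if k = n \<and> l = 1 then P n * state R Q n 1 + P0 * (Q 1)\<^sup>T else P k * state R Q k l))"

lemma append_rows_eq_iff:
  assumes "A \<in> carrier_mat a c" "B \<in> carrier_mat b c" "A' \<in> carrier_mat a c" "B' \<in> carrier_mat b c"
  shows "A @\<^sub>r B = A' @\<^sub>r B' \<longleftrightarrow> A = A' \<and> B = B'"
proof
  assume eq: "A @\<^sub>r B = A' @\<^sub>r B'"
  have d: "dim_row A = a" "dim_col A = c" "dim_row B = b" "dim_col B = c"
    "dim_row A' = a" "dim_col A' = c" "dim_row B' = b" "dim_col B' = c" using assms by auto
  have i: "(A @\<^sub>r B) $$ (i, j) = (A' @\<^sub>r B') $$ (i, j)" for i j using eq by simp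
  have "A $$ (i, j) = A' $$ (i, j)" if "i < a" "j < c" for i j
    using i[of i j] that d by (simp add: append_rows_def)
  moreover have "B $$ (i, j) = B' $$ (i, j)" if "i < b" "j < c" for i j
    using i[of "a + i" j] that d by (simp add: append_rows_def)
  ultimately show "A = A' \<and> B = B'" using d by (auto intro!: eq_matI)
qed simp

text \<open>\<open>A' X\<close> abstracts A(X,Y) with \<open>Y\<close> fixed and, in reversed
  numbering, A(X,Y) with \<open>X\<close> fixed. Only blocks below the diagonal are constrained,
  which is what both readings share.\<close>

locale corner_frame = block_frame +
  fixes A :: "real mat" and A' :: "real mat \<Rightarrow> real mat"
  assumes n: "n \<ge> 3"
    and A_carrier: "A \<in> carrier_mat T T"
    and A'_carrier: "X \<in> carrier_mat (N n) (N 1) \<Longrightarrow> A' X \<in> carrier_mat T T"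
    and A'_block: "X \<in> carrier_mat (N n) (N 1) \<Longrightarrow> 1 \<le> l \<Longrightarrow> l < k \<Longrightarrow> k \<le> n \<Longrightarrow>
      E k * A' X * (E l)\<^sup>T = (if k = n \<and> l = 1 then X else E k * A * (E l)\<^sup>T)"
begin

abbreviation lower_rank :: "nat \<Rightarrow> real mat \<Rightarrow> nat" where
  "lower_rank i M \<equiv> mat_rank (Pi {i+1..n} * M * Pi {1..i})"

abbreviation blk :: "real mat \<Rightarrow> nat \<Rightarrow> nat \<Rightarrow> real mat" where
  "blk M \<equiv> \<lambda>k l. E k * M * (E l)\<^sup>T"

lemma rank_le_dim_of_css_rep:
  assumes X: "X \<in> carrier_mat (N n) (N 1)"
    and min: "\<And>i X'. 1 \<le> i \<Longrightarrow> i < n \<Longrightarrow> X' \<in> carrier_mat (N n) (N 1) \<Longrightarrow>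
      lower_rank i (A' X) \<le> lower_rank i (A' X')"
    and rep: "lower_css_rep n N r P R Q P0 (blk A)"
    and i: "1 \<le> i" "i < n"
  shows "lower_rank i (A' X) \<le> r i"
proof -
  have g: "generators n N r P R Q" using rep by (simp add: lower_css_rep_def)
  \<comment> \<open>This is A_n1 minus the correction term, the corner for which the same generators
    form an ordinary lower SSS representation.\<close>
  let ?X = "P n * state R Q n 1"
  have X': "?X \<in> carrier_mat (N n) (N 1)"
    by (rule mult_carrier_mat[OF P_carrier[OF g] state_carrier[OF g]]) (use n in auto)
  have "lower_rank i (A' ?X) \<le> r i"
  proof (rule rank_le_generators[OF g A'_carrier[OF X'] i])
    fix k l assume kl: "1 \<le> l" "l \<le> i" "i < k" "k \<le> n"
    then have "blk A k l = (if k = n \<and> l = 1 then P n * state R Q n 1 + P0 * (Q 1)\<^sup>T else P k * state R Q k l)"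
      using rep by (simp add: lower_css_rep_def)
    then show "blk (A' ?X) k l = P k * state R Q k l"
      using A'_block[OF X', of l k] kl by auto
  qed
  then show ?thesis using min[OF i X'] by linarith
qed

lemma corner_rank_le_dim_of_css_rep:
  assumes X: "X \<in> carrier_mat (N n) (N 1)"
    and min: "\<And>i X'. 1 \<le> i \<Longrightarrow> i < n \<Longrightarrow> X' \<in> carrier_mat (N n) (N 1) \<Longrightarrow>
      lower_rank i (A' X) \<le> lower_rank i (A' X')"
    and sss: "lower_rep n N r P R Q (blk (A' X))"
    and r: "r 1 = lower_rank 1 (A' X)"
    and rep: "lower_css_rep n N r' P' R' Q' P0 (blk A)"
  shows "mat_rank ((Q 1)\<^sup>T @\<^sub>r (blk A n 1 - X)) \<le> r' 1"
proof -
  have g: "generators n N r P R Q" using sss by (simp add: lower_rep_def)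
  have g': "generators n N r' P' R' Q'" and P0: "P0 \<in> carrier_mat (N n) (r' 1)"
    using rep by (auto simp: lower_css_rep_def)
  have Z: "0\<^sub>m (N n) (N 1) \<in> carrier_mat (N n) (N 1)" by simp
  have Q1: "(Q' 1)\<^sup>T \<in> carrier_mat (r' 1) (N 1)" using Q_carrier[OF g', of 1] n by auto
  \<comment> \<open>The coefficient of the transposed \<open>Q' 1\<close> in the chain from block
    column 1 to block row \<open>k\<close>.\<close>
  define h where "h k = P' k * transfer r' R' k 1" for k
  have h: "h k \<in> carrier_mat (N k) (r' 1)" if "2 \<le> k" "k \<le> n" for k
    unfolding h_def by (rule mult_carrier_mat[OF P_carrier[OF g'] transfer_carrier[OF g']]) (use that in auto)
  have hQ: "P' k * state R' Q' k 1 = h k * (Q' 1)\<^sup>T" if "2 \<le> k" "k \<le> n" for k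
  proof -
    have "state R' Q' k 1 = transfer r' R' k 1 * (Q' 1)\<^sup>T"
      using state_transfer[OF g', of 1 1 k, unfolded state_Suc_self] that by simp
    then show ?thesis unfolding h_def using P_carrier[OF g', of k] transfer_carrier[OF g', of 1 k] Q1 that
      by (simp add: mat_mult_assoc)
  qed
  \<comment> \<open>The correction multiplies the same transposed \<open>Q' 1\<close>, so
    \<open>P0\<close> can be absorbed into the last coefficient and the whole first block column
    factors through it.\<close>
  define h' where "h' k = (if k = n then h n + P0 else h k)" for k
  have "h n * (Q' 1)\<^sup>T + P0 * (Q' 1)\<^sup>T = h' n * (Q' 1)\<^sup>T"
    using add_mult_distrib_mat[OF h[of n] P0 Q1] n by (simp add: h'_def)
  moreover have "blk A n 1 = P' n * state R' Q' n 1 + P0 * (Q' 1)\<^sup>T"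
    using rep n by (simp add: lower_css_rep_def)
  ultimately have An: "blk A n 1 = h' n * (Q' 1)\<^sup>T" using hQ[of n] n by simp
  have Ak: "blk A k 1 = h' k * (Q' 1)\<^sup>T" if "2 \<le> k" "k < n" for k
    using rep that hQ[of k] by (simp add: lower_css_rep_def h'_def)
  have two: "Pi {2..n} * M * Pi {1} = Pi {1+1..n} * M * Pi {1..1}" for M
    by (simp add: numeral_2_eq_2)
  show ?thesis unfolding An
  proof (rule corner_rank_le[OF n g A'_carrier[OF X] _ _ A'_carrier[OF Z]])
    show "blk (A' X) k 1 = P k * state R Q k 1" if "1 < k" "k \<le> n" for k
      using sss that by (simp add: lower_rep_def)
    show "r 1 = mat_rank (Pi {2..n} * A' X * Pi {1})" unfolding two by (rule r)
    show "mat_rank (Pi {2..n} * A' X * Pi {1}) \<le> mat_rank (Pi {2..n} * A' (0\<^sub>m (N n) (N 1)) * Pi {1})"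
      unfolding two by (rule min) (use n in auto)
    show "blk (A' (0\<^sub>m (N n) (N 1))) k 1 = blk (A' X) k 1" if "2 \<le> k" "k < n" for k
      using A'_block[OF X, of 1 k] A'_block[OF Z, of 1 k] that by simp
    show "blk (A' (0\<^sub>m (N n) (N 1))) n 1 = 0\<^sub>m (N n) (N 1)"
      using A'_block[OF Z, of 1 n] n by simp
    show "(Q' 1)\<^sup>T \<in> carrier_mat (r' 1) (N 1)" by (rule Q1)
    show "h' k \<in> carrier_mat (N k) (r' 1)" if "2 \<le> k" "k \<le> n" for k
      using h[OF that] P0 by (auto simp: h'_def)
    show "blk (A' X) k 1 = h' k * (Q' 1)\<^sup>T" if "2 \<le> k" "k < n" for k
      using A'_block[OF X, of 1 k] Ak[OF that] that by simp
    show "X = blk (A' X) n 1" using A'_block[OF X, of 1 n] n by simp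
  qed
qed

text \<open>Since \<open>Q1\<^sup>T * pinv (Q1\<^sup>T)\<close> is the identity,
  \<open>pinv (Q1\<^sup>T) * Q1\<^sup>T\<close> fixes the stacked matrix under right multiplication.
  Its upper half then says that the chains still give the blocks of \<open>A' X\<close>, its lower
  half that the correction adds exactly A_n1 minus \<open>X\<close>.\<close>

lemma css_rep_of_factorization:
  assumes X: "X \<in> carrier_mat (N n) (N 1)"
    and sss: "lower_rep n N r P R Q (blk (A' X))"
    and fact: "rank_factorization ((Q 1)\<^sup>T @\<^sub>r (blk A n 1 - X)) Z Q1\<^sup>T"
  shows "lower_css_rep n N (r(1 := dim_col Q1))
    (P(2 := P 2 * (Q 1)\<^sup>T * pinv (Q1\<^sup>T))) (R(2 := R 2 * (Q 1)\<^sup>T * pinv (Q1\<^sup>T))) (Q(1 := Q1))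
    ((blk A n 1 - X) * pinv (Q1\<^sup>T)) (blk A)"
proof -
  let ?F = "(Q 1)\<^sup>T @\<^sub>r (blk A n 1 - X)" and ?D = "pinv (Q1\<^sup>T)"
  define s where "s = dim_col Q1"
  have g: "generators n N r P R Q" using sss by (simp add: lower_rep_def)
  have Qt: "(Q 1)\<^sup>T \<in> carrier_mat (r 1) (N 1)" using Q_carrier[OF g, of 1] n by auto
  have An: "blk A n 1 - X \<in> carrier_mat (N n) (N 1)" using X by auto
  have F: "?F \<in> carrier_mat (r 1 + N n) (N 1)" by (rule carrier_append_rows[OF Qt An])
  have Z: "Z \<in> carrier_mat (r 1 + N n) s" and Q1t: "Q1\<^sup>T \<in> carrier_mat s (N 1)"
    and FZ: "?F = Z * Q1\<^sup>T" and rk: "mat_rank Q1\<^sup>T = s"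
    using fact unfolding rank_factorization_def carrier_matD[OF F] by (simp_all add: s_def)
  have Q1: "Q1 \<in> carrier_mat (N 1) s" by (rule carrier_matI) (use carrier_matD(2)[OF Q1t] in \<open>simp_all add: s_def\<close>)
  have D: "?D \<in> carrier_mat (N 1) s" and QD: "Q1\<^sup>T * ?D = 1\<^sub>m s"
    using pinv_full_row_rank[OF Q1t rk] by auto
  have "?F * (?D * Q1\<^sup>T) = Z * (Q1\<^sup>T * ?D) * Q1\<^sup>T"
    unfolding FZ using Z Q1t D by (simp add: mat_mult_assoc)
  also have "\<dots> = ?F" unfolding QD using Z FZ by simp
  finally have F_eq: "?F * (?D * Q1\<^sup>T) = ?F" .
  have DQ1: "?D * Q1\<^sup>T \<in> carrier_mat (N 1) (N 1)" by (rule mult_carrier_mat[OF D Q1t])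
  have "((Q 1)\<^sup>T * (?D * Q1\<^sup>T)) @\<^sub>r ((blk A n 1 - X) * (?D * Q1\<^sup>T)) = ?F"
    unfolding append_rows_mult[OF Qt An DQ1] by (rule F_eq)
  then have "(Q 1)\<^sup>T * (?D * Q1\<^sup>T) = (Q 1)\<^sup>T \<and> (blk A n 1 - X) * (?D * Q1\<^sup>T) = blk A n 1 - X"
    using append_rows_eq_iff[OF mult_carrier_mat[OF Qt DQ1] mult_carrier_mat[OF An DQ1] Qt An] by blast
  then have QDQ: "(Q 1)\<^sup>T * ?D * Q1\<^sup>T = (Q 1)\<^sup>T" and XDQ: "(blk A n 1 - X) * ?D * Q1\<^sup>T = blk A n 1 - X"
    using Qt An D Q1t by (simp_all add: mat_mult_assoc)
  let ?P = "P(2 := P 2 * (Q 1)\<^sup>T * ?D)" and ?R = "R(2 := R 2 * (Q 1)\<^sup>T * ?D)" and ?Q = "Q(1 := Q1)"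
  have ch: "?P k * state ?R ?Q k l = blk (A' X) k l" if kl: "1 \<le> l" "l < k" "k \<le> n" for k l
    using chain_update[OF g QDQ D Q1 kl] sss kl by (simp add: lower_rep_def)
  show ?thesis unfolding lower_css_rep_def s_def[symmetric]
  proof (intro conjI allI impI)
    show "generators n N (r(1 := s)) ?P ?R ?Q" by (rule generators_update[OF g n D Q1])
    show "(blk A n 1 - X) * ?D \<in> carrier_mat (N n) ((r(1 := s)) 1)" using mult_carrier_mat[OF An D] by simp
    fix k l assume kl: "1 \<le> l" "l < k" "k \<le> n"
    have "blk A n 1 = X + (blk A n 1 - X)" using X n A_carrier by (intro eq_matI) auto
    then show "blk A k l = (if k = n \<and> l = 1 then ?P n * state ?R ?Q n 1 + (blk A n 1 - X) * ?D * (?Q 1)\<^sup>T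
        else ?P k * state ?R ?Q k l)"
      using A'_block[OF X kl] ch[OF kl] ch[of 1 n] n XDQ by (auto simp del: fun_upd_apply simp: fun_upd_same)
  qed
qed

lemma uniformly_minimal:
  assumes X: "X \<in> carrier_mat (N n) (N 1)"
    and min: "\<And>i X'. 1 \<le> i \<Longrightarrow> i < n \<Longrightarrow> X' \<in> carrier_mat (N n) (N 1) \<Longrightarrow>
      lower_rank i (A' X) \<le> lower_rank i (A' X')"
    and sss: "lower_rep n N r P R Q (blk (A' X))"
    and r: "\<And>i. 1 \<le> i \<Longrightarrow> i < n \<Longrightarrow> r i = lower_rank i (A' X)"
    and fact: "rank_factorization ((Q 1)\<^sup>T @\<^sub>r (blk A n 1 - X)) Z Q1\<^sup>T"
    and rep: "lower_css_rep n N r' P' R' Q' P0 (blk A)"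
    and i: "1 \<le> i" "i < n"
  shows "(r(1 := dim_col Q1)) i \<le> r' i"
proof (cases "i = 1")
  case True
  have "dim_col Q1 = mat_rank ((Q 1)\<^sup>T @\<^sub>r (blk A n 1 - X))"
    using fact unfolding rank_factorization_def by (metis index_transpose_mat(2))
  also have "\<dots> \<le> r' 1"
    by (rule corner_rank_le_dim_of_css_rep[OF X min sss r rep]) (use n in auto)
  finally show ?thesis using True by simp
next
  case False
  then show ?thesis using rank_le_dim_of_css_rep[OF X min rep i] r[OF i] by simp
qed

end

section \<open>Selection matrices and the rank of a submatrix\<close>

definition select :: "nat \<Rightarrow> nat \<Rightarrow> (nat \<Rightarrow> bool) \<Rightarrow> (nat \<Rightarrow> nat) \<Rightarrow> real mat" where
  "select a T p f = mat a T (\<lambda>(i, j). if p i \<and> j = f i then 1 else 0)"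

lemma select_carrier [simp]: "select a T p f \<in> carrier_mat a T"
  and select_dim [simp]: "dim_row (select a T p f) = a" "dim_col (select a T p f) = T"
  by (auto simp: select_def)

lemma select_mult:
  assumes A: "A \<in> carrier_mat T c" and f: "\<And>i. i < a \<Longrightarrow> p i \<Longrightarrow> f i < T"
  shows "select a T p f * A = mat a c (\<lambda>(i, j). if p i then A $$ (f i, j) else 0)"
proof (rule eq_matI)
  fix i j assume "i < dim_row (mat a c (\<lambda>(i, j). if p i then A $$ (f i, j) else 0))"
    "j < dim_col (mat a c (\<lambda>(i, j). if p i then A $$ (f i, j) else 0))"
  then have ij: "i < a" "j < c" by auto
  have "(select a T p f * A) $$ (i, j) = (\<Sum>k<T. (if p i \<and> k = f i then 1 else 0) * A $$ (k, j))"
    using A ij by (auto simp: select_def scalar_prod_def atLeast0LessThan intro!: sum.cong)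
  also have "\<dots> = (\<Sum>k<T. if k = f i then (if p i then A $$ (f i, j) else 0) else 0)"
    by (rule sum.cong) auto
  also have "\<dots> = (if p i then A $$ (f i, j) else 0)" using f[OF ij(1)] by (simp add: sum.delta)
  finally show "(select a T p f * A) $$ (i, j) = mat a c (\<lambda>(i, j). if p i then A $$ (f i, j) else 0) $$ (i, j)"
    using ij by simp
qed (use A in auto)

lemma mult_select_transpose:
  assumes A: "A \<in> carrier_mat c T" and f: "\<And>i. i < a \<Longrightarrow> p i \<Longrightarrow> f i < T"
  shows "A * (select a T p f)\<^sup>T = mat c a (\<lambda>(i, j). if p j then A $$ (i, f j) else 0)"
proof -
  have "A * (select a T p f)\<^sup>T = (select a T p f * A\<^sup>T)\<^sup>T"
    using A by (subst transpose_mult[of _ a T _ c]) auto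
  also have "select a T p f * A\<^sup>T = mat a c (\<lambda>(i, j). if p i then A\<^sup>T $$ (f i, j) else 0)"
    by (rule select_mult) (use A f in auto)
  finally show ?thesis using A f by (auto intro!: eq_matI)
qed

lemma pick_in_of_card:
  assumes "i < card {x. x < T \<and> x \<in> I}"
  shows "pick I i \<in> I"
proof (cases "finite I")
  case True
  then have "card {x. x < T \<and> x \<in> I} \<le> card I" by (auto intro: card_mono)
  then show ?thesis using assms pick_in_set_le by simp
qed (rule pick_in_set_inf)

lemma submatrix_eq_select:
  assumes M: "M \<in> carrier_mat T T"
  shows "submatrix M I J = select (card {i. i < T \<and> i \<in> I}) T (\<lambda>_. True) (pick I) * M *
    (select (card {j. j < T \<and> j \<in> J}) T (\<lambda>_. True) (pick J))\<^sup>T"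
proof -
  let ?a = "card {i. i < T \<and> i \<in> I}" and ?b = "card {j. j < T \<and> j \<in> J}"
  have 1: "select ?a T (\<lambda>_. True) (pick I) * M = mat ?a T (\<lambda>(i, j). M $$ (pick I i, j))"
    by (subst select_mult[OF M]) (auto simp: pick_le)
  show ?thesis unfolding 1
    by (subst mult_select_transpose[of _ ?a]) (use M in \<open>auto simp: pick_le submatrix_def intro!: eq_matI\<close>)
qed

text \<open>\<open>?S\<close> lists the selected rows, \<open>?D\<close> zeroes the others, and
  \<open>?W\<close> puts listed rows back in place: an index \<open>i\<close> of \<open>I\<close> is
  the one numbered \<open>card {x \<in> I. x < i}\<close>. As \<open>?S I * ?D I = ?S I\<close> and
  \<open>?W I * ?S I = ?D I\<close>, each of the two matrices arises from the other by
  multiplication on both sides.\<close>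

lemma mat_rank_submatrix:
  assumes M: "M \<in> carrier_mat T T"
  shows "mat_rank (submatrix M I J) =
    mat_rank (select T T (\<lambda>i. i \<in> I) (\<lambda>i. i) * M * select T T (\<lambda>j. j \<in> J) (\<lambda>j. j))"
proof -
  let ?c = "\<lambda>I. card {i. i < T \<and> i \<in> I}"
  let ?S = "\<lambda>I. select (?c I) T (\<lambda>_. True) (pick I)" and ?D = "\<lambda>I. select T T (\<lambda>i. i \<in> I) (\<lambda>i. i)"
  let ?W = "\<lambda>I. select T (?c I) (\<lambda>i. i \<in> I) (\<lambda>i. card {x \<in> I. x < i})"
  have cl: "card {x \<in> I. x < i} < ?c I" if "i \<in> I" "i < T" for i I
    by (rule psubset_card_mono) (use that in auto)
  have SD: "?S I * ?D I = ?S I" for I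
  proof -
    have "?S I * ?D I = mat (?c I) T (\<lambda>(i, j). ?D I $$ (pick I i, j))"
      by (subst select_mult[of _ T T]) (auto simp: pick_le)
    also have "\<dots> = ?S I"
      by (rule eq_matI) (auto simp: select_def pick_le pick_in_of_card)
    finally show ?thesis .
  qed
  have WS: "?W I * ?S I = ?D I" for I
  proof -
    have "?W I * ?S I = mat T T (\<lambda>(i, j). if i \<in> I then ?S I $$ (card {x \<in> I. x < i}, j) else 0)"
      by (subst select_mult[of _ "?c I" T]) (auto simp: cl)
    also have "\<dots> = ?D I"
      by (rule eq_matI) (auto simp: select_def cl pick_card_in_set)
    finally show ?thesis .
  qed
  have Dt: "(?D I)\<^sup>T = ?D I" for I by (rule eq_matI) (auto simp: select_def)
  have dM: "dim_row M = T" "dim_col M = T" using M by auto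
  have DS: "?D I * (?S I)\<^sup>T = (?S I)\<^sup>T" for I
    using arg_cong[OF SD[of I], of transpose_mat] transpose_mult[of "?S I" "?c I" T "?D I" T] by (simp add: Dt)
  have SW: "(?S I)\<^sup>T * (?W I)\<^sup>T = ?D I" for I
    using arg_cong[OF WS[of I], of transpose_mat] transpose_mult[of "?W I" T "?c I" "?S I" T] by (simp add: Dt)
  have le: "mat_rank (A * B * C) \<le> mat_rank B"
    if "A \<in> carrier_mat a b" "B \<in> carrier_mat b c" "C \<in> carrier_mat c d" for A B C a b c d
    using mat_rank_mult_right_le[OF mult_carrier_mat[OF that(1,2)] that(3)] mat_rank_mult_left_le[OF that(1,2)] by simp
  have "submatrix M I J = (?S I * ?D I) * M * (?D J * (?S J)\<^sup>T)"
    unfolding SD DS by (rule submatrix_eq_select[OF M])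
  also have "\<dots> = ?S I * (?D I * M * ?D J) * (?S J)\<^sup>T" by (simp add: mat_mult_assoc dM)
  finally have "mat_rank (submatrix M I J) \<le> mat_rank (?D I * M * ?D J)"
    using le[of "?S I" "?c I" T "?D I * M * ?D J" T "(?S J)\<^sup>T" "?c J"] by (simp add: carrier_matI dM)
  moreover have "?D I * M * ?D J = ?W I * submatrix M I J * (?W J)\<^sup>T"
  proof -
    have "?D I * M * ?D J = (?W I * ?S I) * M * ((?S J)\<^sup>T * (?W J)\<^sup>T)" unfolding WS SW ..
    also have "\<dots> = ?W I * (?S I * M * (?S J)\<^sup>T) * (?W J)\<^sup>T" by (simp add: mat_mult_assoc dM)
    finally show ?thesis unfolding submatrix_eq_select[OF M] .
  qed
  moreover have "submatrix M I J \<in> carrier_mat (?c I) (?c J)"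
    by (rule carrier_matI) (simp_all add: dim_submatrix dM)
  ultimately show ?thesis using le[of "?W I" T "?c I" "submatrix M I J" "?c J" "(?W J)\<^sup>T" T] by simp
qed

section \<open>The block structure of a partitioned matrix\<close>

lemma offset_Suc: "1 \<le> k \<Longrightarrow> offset N (Suc k) = offset N k + N k"
  by (simp add: offset_def)

lemma offset_mono: "k \<le> l \<Longrightarrow> offset N k \<le> offset N l"
  unfolding offset_def by (rule sum_mono2) auto

lemma offset_le_total: "k \<in> {1..n} \<Longrightarrow> offset N k + N k \<le> total_size n N"
  using offset_mono[of "Suc k" "Suc n" N] offset_Suc[of k N]
  by (simp add: total_size_def offset_def atLeastLessThanSuc_atLeastAtMost)

text \<open>Blocks may be empty and then share their offset with the next block; the bounds on
  \<open>i\<close> and \<open>j\<close> are what keeps the position unique.\<close>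

lemma offset_inj:
  assumes "1 \<le> k" "1 \<le> l" "i < N k" "j < N l" "offset N k + i = offset N l + j"
  shows "k = l \<and> i = j"
proof -
  have "\<not> k < l" using offset_mono[of "Suc k" l N] offset_Suc[of k N] assms by auto
  moreover have "\<not> l < k" using offset_mono[of "Suc l" k N] offset_Suc[of l N] assms by auto
  ultimately show ?thesis using assms by simp
qed

lemma offset_less_total: "k \<in> {1..n} \<Longrightarrow> i < N k \<Longrightarrow> offset N k + i < total_size n N"
  using offset_le_total[of k n N] by linarith

text \<open>Index 0 is barred from \<open>K\<close> because \<open>offset N 0\<close> equals
  \<open>offset N 1\<close>, so a block 0 could overlap genuine blocks.\<close>

lemma offset_in_block_indices:
  assumes "1 \<le> k" "i < N k" "0 \<notin> K"
  shows "offset N k + i \<in> block_indices N K \<longleftrightarrow> k \<in> K"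
proof
  assume "offset N k + i \<in> block_indices N K"
  then obtain l where l: "l \<in> K" "offset N l \<le> offset N k + i" "offset N k + i < offset N l + N l"
    by (auto simp: block_indices_def)
  moreover have "1 \<le> l" using l assms(3) by (cases l) auto
  ultimately have "k = l" using offset_inj[of k l i N "offset N k + i - offset N l"] assms by auto
  then show "k \<in> K" using l by simp
qed (use assms in \<open>auto simp: block_indices_def intro!: bexI[of _ k]\<close>)

lemma in_block_indicesE:
  assumes "x \<in> block_indices N K"
  obtains k i where "k \<in> K" "i < N k" "x = offset N k + i"
proof -
  obtain k where "k \<in> K" "offset N k \<le> x" "x < offset N k + N k" using assms by (auto simp: block_indices_def)
  then show ?thesis using that[of k "x - offset N k"] by auto
qed

definition block_rows :: "nat \<Rightarrow> (nat \<Rightarrow> nat) \<Rightarrow> nat \<Rightarrow> real mat" where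
  "block_rows n N k = select (N k) (total_size n N) (\<lambda>_. True) (\<lambda>i. offset N k + i)"

text \<open>Intersecting with \<open>{1..n}\<close> removes the spurious block 0, so that the axioms
  of \<open>block_frame\<close> hold for arbitrary index sets.\<close>

definition block_proj :: "nat \<Rightarrow> (nat \<Rightarrow> nat) \<Rightarrow> nat set \<Rightarrow> real mat" where
  "block_proj n N K =
     select (total_size n N) (total_size n N) (\<lambda>i. i \<in> block_indices N (K \<inter> {1..n})) (\<lambda>i. i)"

lemma block_rows_mult:
  assumes "k \<in> {1..n}" "A \<in> carrier_mat (total_size n N) c"
  shows "block_rows n N k * A = mat (N k) c (\<lambda>(i, j). A $$ (offset N k + i, j))"
  unfolding block_rows_def by (subst select_mult[OF assms(2)]) (use assms(1) offset_less_total in auto)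

lemma block_proj_mult:
  assumes "A \<in> carrier_mat (total_size n N) c"
  shows "block_proj n N K * A =
    mat (total_size n N) c (\<lambda>(i, j). if i \<in> block_indices N (K \<inter> {1..n}) then A $$ (i, j) else 0)"
  unfolding block_proj_def by (subst select_mult[OF assms]) auto

lemma block_frame_concrete: "block_frame n N (total_size n N) (block_rows n N) (block_proj n N)"
proof
  let ?T = "total_size n N"
  fix k :: nat
  show c: "block_rows n N k \<in> carrier_mat (N k) ?T" by (simp add: block_rows_def)
  fix K :: "nat set"
  assume k: "k \<in> {1..n}"
  have P: "block_proj n N K \<in> carrier_mat ?T ?T" by (simp add: block_proj_def)
  have "block_rows n N k * block_proj n N K =
      mat (N k) ?T (\<lambda>(i, j). block_proj n N K $$ (offset N k + i, j))"
    by (rule block_rows_mult[OF k P])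
  also have "\<dots> = (if k \<in> K then block_rows n N k else 0\<^sub>m (N k) ?T)"
    using k offset_less_total[OF k] offset_in_block_indices[of k _ N "K \<inter> {1..n}"]
    by (intro eq_matI) (auto simp: block_proj_def block_rows_def select_def)
  finally show "block_rows n N k * block_proj n N K = (if k \<in> K then block_rows n N k else 0\<^sub>m (N k) ?T)" .
next
  let ?T = "total_size n N"
  fix K L :: "nat set"
  show "block_proj n N K \<in> carrier_mat ?T ?T" by (simp add: block_proj_def)
  show "(block_proj n N K)\<^sup>T = block_proj n N K"
    by (rule eq_matI) (auto simp: block_proj_def select_def)
  have P: "block_proj n N L \<in> carrier_mat ?T ?T" by (simp add: block_proj_def)
  have KL: "x \<in> block_indices N (K \<inter> L \<inter> {1..n}) \<longleftrightarrow>
      x \<in> block_indices N (K \<inter> {1..n}) \<and> x \<in> block_indices N (L \<inter> {1..n})" for x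
  proof
    assume x: "x \<in> block_indices N (K \<inter> {1..n}) \<and> x \<in> block_indices N (L \<inter> {1..n})"
    then obtain k i where "k \<in> K \<inter> {1..n}" "i < N k" "x = offset N k + i" by (auto elim: in_block_indicesE)
    then show "x \<in> block_indices N (K \<inter> L \<inter> {1..n})"
      using x offset_in_block_indices[of k i N "L \<inter> {1..n}"] offset_in_block_indices[of k i N "K \<inter> L \<inter> {1..n}"] by auto
  qed (auto simp: block_indices_def)
  show "block_proj n N K * block_proj n N L = block_proj n N (K \<inter> L)"
    unfolding block_proj_mult[OF P]
    by (rule eq_matI) (auto simp: block_proj_def select_def KL[unfolded One_nat_def])
next
  let ?T = "total_size n N"
  fix A B :: "real mat" and c K
  assume A: "A \<in> carrier_mat ?T c" and B: "B \<in> carrier_mat ?T c" and K: "K \<subseteq> {1..n}"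
    and eq: "\<And>k. k \<in> K \<Longrightarrow> block_rows n N k * A = block_rows n N k * B"
  have "A $$ (x, j) = B $$ (x, j)" if x: "x \<in> block_indices N (K \<inter> {1..n})" and j: "j < c" for x j
  proof -
    obtain k i where k: "k \<in> K" "k \<in> {1..n}" "i < N k" "x = offset N k + i"
      using x by (auto elim: in_block_indicesE)
    have "(block_rows n N k * A) $$ (i, j) = (block_rows n N k * B) $$ (i, j)" using eq[OF k(1)] by simp
    then show ?thesis unfolding block_rows_mult[OF k(2) A] block_rows_mult[OF k(2) B] using k j by simp
  qed
  then show "block_proj n N K * A = block_proj n N K * B"
    unfolding block_proj_mult[OF A] block_proj_mult[OF B] by (auto intro!: eq_matI)
next
  let ?T = "total_size n N"
  fix X :: "nat \<Rightarrow> real mat" and c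
  assume X: "\<And>k. k \<in> {1..n} \<Longrightarrow> X k \<in> carrier_mat (N k) c"
  \<comment> \<open>\<open>b x\<close> recovers the block that contains the entry index
    \<open>x\<close>; \<open>offset_inj\<close> makes it unique.\<close>
  define b where "b x = (SOME k. k \<in> {1..n} \<and> (\<exists>i < N k. x = offset N k + i))" for x
  have b: "b (offset N k + i) = k" if "k \<in> {1..n}" "i < N k" for k i
    unfolding b_def
  proof (rule some_equality)
    show "k \<in> {1..n} \<and> (\<exists>j < N k. offset N k + i = offset N k + j)" using that by auto
    fix l assume "l \<in> {1..n} \<and> (\<exists>j < N l. offset N k + i = offset N l + j)"
    then show "l = k" using offset_inj[of k l i N] that by auto
  qed
  define S where "S = mat ?T c (\<lambda>(x, j). X (b x) $$ (x - offset N (b x), j))"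
  have S: "S \<in> carrier_mat ?T c" by (simp add: S_def)
  have "block_rows n N k * S = X k" if k: "k \<in> {1..n}" for k
    unfolding block_rows_mult[OF k S]
    by (rule eq_matI) (use X[OF k] k b offset_less_total[OF k] in \<open>auto simp: S_def\<close>)
  then show "\<exists>S\<in>carrier_mat ?T c. \<forall>k\<in>{1..n}. block_rows n N k * S = X k" using S by blast
qed

lemma block_index:
  assumes M: "M \<in> carrier_mat (total_size n N) (total_size n N)" and k: "k \<in> {1..n}" and l: "l \<in> {1..n}"
  shows "block N M k l = mat (N k) (N l) (\<lambda>(i, j). M $$ (offset N k + i, offset N l + j))"
proof -
  have s: "{i. i < total_size n N \<and> i \<in> block_indices N {k}} = {offset N k..<offset N k + N k}" if "k \<in> {1..n}" for k
    using offset_le_total[OF that, of N] by (auto simp: block_indices_def)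
  have p: "pick (block_indices N {k}) i = offset N k + i" if "i < N k" for k i
  proof -
    have "{a \<in> block_indices N {k}. a < offset N k + i} = {offset N k..<offset N k + i}"
      using that by (auto simp: block_indices_def)
    then show ?thesis
      using pick_card_in_set[of "offset N k + i" "block_indices N {k}"] that by (simp add: block_indices_def)
  qed
  show ?thesis unfolding block_def block_submatrix_def submatrix_def
    by (rule eq_matI) (use M in \<open>auto simp: s[OF k] s[OF l] p\<close>)
qed

lemma block_eq_rows:
  assumes M: "M \<in> carrier_mat (total_size n N) (total_size n N)" and k: "k \<in> {1..n}" and l: "l \<in> {1..n}"
  shows "block N M k l = block_rows n N k * M * (block_rows n N l)\<^sup>T"
proof -
  have kM: "block_rows n N k * M \<in> carrier_mat (N k) (total_size n N)" using M by (simp add: block_rows_mult[OF k])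
  have "block_rows n N k * M * (block_rows n N l)\<^sup>T =
      mat (N k) (N l) (\<lambda>(i, j). (block_rows n N k * M) $$ (i, offset N l + j))"
    unfolding block_rows_def[of n N l]
    by (subst mult_select_transpose) (use kM offset_less_total[OF l] in auto)
  also have "\<dots> = block N M k l" unfolding block_index[OF assms] block_rows_mult[OF k M]
    by (rule eq_matI) (use offset_less_total[OF l] in auto)
  finally show ?thesis ..
qed

lemma block_carrier:
  assumes "M \<in> carrier_mat (total_size n N) (total_size n N)" "k \<in> {1..n}" "l \<in> {1..n}"
  shows "block N M k l \<in> carrier_mat (N k) (N l)"
  by (simp add: block_index[OF assms])

lemma mat_rank_block_submatrix:
  assumes M: "M \<in> carrier_mat (total_size n N) (total_size n N)" and "I \<subseteq> {1..n}" "J \<subseteq> {1..n}"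
  shows "mat_rank (block_submatrix N M I J) = mat_rank (block_proj n N I * M * block_proj n N J)"
  unfolding block_submatrix_def mat_rank_submatrix[OF M] block_proj_def using assms(2,3)
  by (simp add: Int_absorb2)

lemma replace_corners_carrier:
  "A \<in> carrier_mat m m \<Longrightarrow> replace_corners n N A X Y \<in> carrier_mat m m"
  by (simp add: replace_corners_def)

lemma block_replace_corners:
  assumes A: "A \<in> carrier_mat (total_size n N) (total_size n N)" and n: "n \<ge> 2"
    and X: "X \<in> carrier_mat (N n) (N 1)" and Y: "Y \<in> carrier_mat (N 1) (N n)"
    and k: "k \<in> {1..n}" and l: "l \<in> {1..n}"
  shows "block N (replace_corners n N A X Y) k l =
    (if k = n \<and> l = 1 then X else if k = 1 \<and> l = n then Y else block N A k l)"
  unfolding block_index[OF replace_corners_carrier[OF A] k l] block_index[OF A k l]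
  using A n X Y k l offset_less_total[OF k, of _ N] offset_less_total[OF l, of _ N]
    offset_in_block_indices[of k _ N "{1}"] offset_in_block_indices[of k _ N "{n}"]
    offset_in_block_indices[of l _ N "{1}"] offset_in_block_indices[of l _ N "{n}"]
  by (intro eq_matI) (auto simp: replace_corners_def)

section \<open>SSS and CSS representations as pairs of lower triangular ones\<close>

lemma lower_entry_state: "lower_entry s k l = Pmat s k * state (Rmat s) (Qmat s) k l"
  by (simp add: lower_entry_def state_def)

text \<open>Reflecting the indices reverses the order of application, which turns the
  \<open>foldr\<close> of \<open>upper_entry\<close> into the \<open>fold\<close> of
  \<open>state\<close>.\<close>

lemma fold_reverse_index:
  assumes "k \<le> l" "l \<le> Suc n"
  shows "foldr f [k..<l] x = fold (\<lambda>i. f (n - i)) [Suc n - l..<Suc n - k] x"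
  using assms
proof (induction k rule: inc_induct)
  case base
  then show ?case by simp
next
  case (step k)
  have "[Suc n - l..<Suc n - k] = [Suc n - l..<Suc n - Suc k] @ [n - k]"
    using step by (simp add: Suc_diff_le)
  moreover have "[k..<l] = k # [Suc k..<l]" using step by (simp add: upt_conv_Cons)
  ultimately show ?case using step by simp
qed

text \<open>Numbering the blocks backwards turns upper generators into lower ones.\<close>

abbreviation rev_ix :: "nat \<Rightarrow> (nat \<Rightarrow> 'a) \<Rightarrow> nat \<Rightarrow> 'a" where
  "rev_ix n f \<equiv> \<lambda>i. f (n + 1 - i)"

lemma upper_entry_state:
  assumes "1 \<le> k" "k < l" "l \<le> n"
  shows "upper_entry s k l =
    rev_ix n (Umat s) (n+1-k) * state (rev_ix n (Wmat s)) (rev_ix n (Vmat s)) (n+1-k) (n+1-l)"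
proof -
  have "foldr (\<lambda>i M. Wmat s i * M) [k+1..<l] x
      = fold (\<lambda>i M. Wmat s (n+1-i) * M) [n+1-l+1..<n+1-k] x" for x
    using fold_reverse_index[of "k+1" l "Suc n" "\<lambda>i M. Wmat s i * M" x] assms by (simp add: Suc_diff_le)
  then show ?thesis using assms by (simp add: upper_entry_def state_def)
qed

text \<open>Blocks are reflected by \<open>n + 1 - i\<close> but dimensions by \<open>n - i\<close>,
  because \<open>rg s i\<close> belongs to the gap between blocks \<open>i\<close> and
  \<open>i + 1\<close>.\<close>

lemma sss_dims_iff:
  "sss_dims n N s \<longleftrightarrow> generators n N (rh s) (Pmat s) (Rmat s) (Qmat s) \<and>
     generators n (rev_ix n N) (\<lambda>i. rg s (n - i)) (rev_ix n (Umat s)) (rev_ix n (Wmat s)) (rev_ix n (Vmat s)) \<and>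
     (\<forall>i\<in>{1..n}. Dmat s i \<in> carrier_mat (N i) (N i))"
proof -
  have rev: "(\<forall>i\<in>{a..b}. F i) \<longleftrightarrow> (\<forall>i\<in>{n+1-b..n+1-a}. F (n+1-i))" if "1 \<le> a" "b \<le> n" for a b and F :: "nat \<Rightarrow> bool"
  proof safe
    fix i assume F: "\<forall>i\<in>{n+1-b..n+1-a}. F (n+1-i)" and i: "i \<in> {a..b}"
    have "n+1-i \<in> {n+1-b..n+1-a}" using i by (simp add: diff_le_mono2)
    moreover have "n+1-(n+1-i) = i" using i that by auto
    ultimately show "F i" using F by metis
  next
    fix i assume F: "\<forall>i\<in>{a..b}. F i" and i: "i \<in> {n+1-b..n+1-a}"
    have "n+1-i \<in> {a..b}" using i that unfolding atLeastAtMost_iff by arith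
    then show "F (n+1-i)" using F by blast
  qed
  have U: "(\<forall>i\<in>{1..n-1}. Umat s i \<in> carrier_mat (N i) (rg s i)) \<longleftrightarrow>
      (\<forall>i\<in>{2..n}. rev_ix n (Umat s) i \<in> carrier_mat (rev_ix n N i) (rg s (n - (i-1))))"
  proof (cases "n = 0")
    case False
    have e: "{n+1-(n-1)..n+1-1} = {2..n}" using False by auto
    show ?thesis by (subst rev) (auto simp: e)
  qed simp
  have W: "(\<forall>i\<in>{2..n-1}. Wmat s i \<in> carrier_mat (rg s (i-1)) (rg s i)) \<longleftrightarrow>
      (\<forall>i\<in>{2..n-1}. rev_ix n (Wmat s) i \<in> carrier_mat (rg s (n - i)) (rg s (n - (i-1))))"
  proof (cases "n = 0")
    case False
    have e: "{n+1-(n-1)..n+1-2} = {2..n-1}" using False by auto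
    show ?thesis by (subst rev) (auto simp: e)
  qed simp
  have V: "(\<forall>i\<in>{2..n}. Vmat s i \<in> carrier_mat (N i) (rg s (i-1))) \<longleftrightarrow>
      (\<forall>i\<in>{1..n-1}. rev_ix n (Vmat s) i \<in> carrier_mat (rev_ix n N i) (rg s (n - i)))"
  proof -
    have e: "{n+1-n..n+1-2} = {1..n-1}" by auto
    show ?thesis by (subst rev) (auto simp: e)
  qed
  show ?thesis unfolding sss_dims_def generators_def U W V by blast
qed

lemma reverse_pairs:
  "(\<forall>k\<in>{1..n}. \<forall>l\<in>{1..n}. k < l \<longrightarrow> F k l) \<longleftrightarrow>
    (\<forall>k l. 1 \<le> l \<longrightarrow> l < k \<longrightarrow> k \<le> n \<longrightarrow> F (n+1-k) (n+1-l))" for n :: nat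
proof safe
  fix k l assume F: "\<forall>k\<in>{1..n}. \<forall>l\<in>{1..n}. k < l \<longrightarrow> F k l" and "1 \<le> l" "l < k" "k \<le> n"
  then have "n+1-k \<in> {1..n}" "n+1-l \<in> {1..n}" "n+1-k < n+1-l" by auto
  then show "F (n+1-k) (n+1-l)" using F by blast
next
  fix k l assume F: "\<forall>k l. 1 \<le> l \<longrightarrow> l < k \<longrightarrow> k \<le> n \<longrightarrow> F (n+1-k) (n+1-l)"
    and "k \<in> {1..n}" "l \<in> {1..n}" "k < l"
  then have "1 \<le> n+1-l" "n+1-l < n+1-k" "n+1-k \<le> n" "n+1-(n+1-k) = k" "n+1-(n+1-l) = l" by auto
  then show "F k l" using F by metis
qed

text \<open>The sizes of \<open>Dmat\<close> are recovered from the diagonal equations; the rest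
  splits into two independent lower triangular conditions, one of them in reversed
  numbering.\<close>

lemma is_sss_iff:
  assumes M: "M \<in> carrier_mat (total_size n N) (total_size n N)"
  shows "is_sss n N M s \<longleftrightarrow>
    lower_rep n N (rh s) (Pmat s) (Rmat s) (Qmat s) (block N M) \<and>
    lower_rep n (rev_ix n N) (\<lambda>i. rg s (n - i)) (rev_ix n (Umat s)) (rev_ix n (Wmat s)) (rev_ix n (Vmat s))
      (\<lambda>k l. block N M (n+1-k) (n+1-l)) \<and>
    (\<forall>i\<in>{1..n}. block N M i i = Dmat s i)"
proof -
  have blocks: "(\<forall>k\<in>{1..n}. \<forall>l\<in>{1..n}. block N M k l =
        (if k = l then Dmat s k else if k > l then lower_entry s k l else upper_entry s k l)) \<longleftrightarrow>
      (\<forall>i\<in>{1..n}. block N M i i = Dmat s i) \<and>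
      (\<forall>k l. 1 \<le> l \<longrightarrow> l < k \<longrightarrow> k \<le> n \<longrightarrow> block N M k l = lower_entry s k l) \<and>
      (\<forall>k\<in>{1..n}. \<forall>l\<in>{1..n}. k < l \<longrightarrow> block N M k l = upper_entry s k l)"
    (is "?L \<longleftrightarrow> ?R1 \<and> ?R2 \<and> ?R3")
  proof (intro iffI conjI)
    assume L: ?L
    show ?R1 using L by auto
    show ?R2 using L by auto
    show ?R3 using L by auto
  next
    assume R: "?R1 \<and> ?R2 \<and> ?R3"
    show ?L
    proof (intro ballI)
      fix k l assume "k \<in> {1..n}" "l \<in> {1..n}"
      then show "block N M k l =
          (if k = l then Dmat s k else if k > l then lower_entry s k l else upper_entry s k l)"
        using R by (cases k l rule: linorder_cases) auto
    qed
  qed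
  have upper: "?R3 \<longleftrightarrow> (\<forall>k l. 1 \<le> l \<longrightarrow> l < k \<longrightarrow> k \<le> n \<longrightarrow> block N M (n+1-k) (n+1-l) =
      rev_ix n (Umat s) k * state (rev_ix n (Wmat s)) (rev_ix n (Vmat s)) k l)"
    unfolding reverse_pairs
    by (intro all_cong1 imp_cong refl) (auto simp: upper_entry_state[of _ _ n])
  have diag: "\<forall>i\<in>{1..n}. Dmat s i \<in> carrier_mat (N i) (N i)"
    if "\<forall>i\<in>{1..n}. block N M i i = Dmat s i"
  proof
    fix i assume i: "i \<in> {1..n}"
    then show "Dmat s i \<in> carrier_mat (N i) (N i)" using block_carrier[OF M i i] that by simp
  qed
  have perm: "(g \<and> g' \<and> d) \<and> (r \<and> u \<and> w) \<longleftrightarrow> (g \<and> u) \<and> (g' \<and> w) \<and> r" if "r \<Longrightarrow> d" for g g' d r u w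
    using that by blast
  show ?thesis unfolding is_sss_def sss_dims_iff lower_rep_def
    unfolding blocks upper unfolding lower_entry_state by (rule perm) (rule diag)
qed

lemma is_css_iff:
  assumes A: "A \<in> carrier_mat (total_size n N) (total_size n N)" and n: "n \<ge> 3"
  shows "is_css n N A c \<longleftrightarrow>
    lower_css_rep n N (rh c) (Pmat c) (Rmat c) (Qmat c) (P0mat c) (block N A) \<and>
    lower_css_rep n (rev_ix n N) (\<lambda>i. rg c (n - i)) (rev_ix n (Umat c)) (rev_ix n (Wmat c)) (rev_ix n (Vmat c))
      (U0mat c) (\<lambda>k l. block N A (n+1-k) (n+1-l)) \<and>
    (\<forall>i\<in>{1..n}. block N A i i = Dmat c i)"
proof -
  let ?lo = "\<lambda>k l. if k = n \<and> l = 1 then lower_entry c n 1 + P0mat c * (Qmat c 1)\<^sup>T else lower_entry c k l"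
  let ?up = "\<lambda>k l. if k = 1 \<and> l = n then upper_entry c 1 n + U0mat c * (Vmat c n)\<^sup>T else upper_entry c k l"
  have blocks: "(\<forall>k\<in>{1..n}. \<forall>l\<in>{1..n}. block N A k l =
        (if k = l then Dmat c k
         else if k = n \<and> l = 1 then lower_entry c n 1 + P0mat c * (Qmat c 1)\<^sup>T
         else if k = 1 \<and> l = n then upper_entry c 1 n + U0mat c * (Vmat c n)\<^sup>T
         else if k > l then lower_entry c k l
         else upper_entry c k l)) \<longleftrightarrow>
      (\<forall>i\<in>{1..n}. block N A i i = Dmat c i) \<and>
      (\<forall>k l. 1 \<le> l \<longrightarrow> l < k \<longrightarrow> k \<le> n \<longrightarrow> block N A k l = ?lo k l) \<and>
      (\<forall>k\<in>{1..n}. \<forall>l\<in>{1..n}. k < l \<longrightarrow> block N A k l = ?up k l)"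
    (is "?L \<longleftrightarrow> ?R1 \<and> ?R2 \<and> ?R3")
  proof (intro iffI conjI)
    assume L: ?L
    show ?R1 using L by auto
    show ?R2
    proof (intro allI impI)
      fix k l assume "1 \<le> l" "l < k" "k \<le> n"
      then show "block N A k l = ?lo k l" using L[rule_format, of k l] by auto
    qed
    show ?R3
    proof (intro ballI impI)
      fix k l assume "k \<in> {1..n}" "l \<in> {1..n}" "k < l"
      then show "block N A k l = ?up k l" using L[rule_format, of k l] by auto
    qed
  next
    assume R: "?R1 \<and> ?R2 \<and> ?R3"
    show ?L
    proof (intro ballI)
      fix k l assume kl: "k \<in> {1..n}" "l \<in> {1..n}"
      consider "k = l" | "l < k" "block N A k l = ?lo k l" | "k < l" "block N A k l = ?up k l"
        using R kl by (cases k l rule: linorder_cases) auto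
      then show "block N A k l =
        (if k = l then Dmat c k
         else if k = n \<and> l = 1 then lower_entry c n 1 + P0mat c * (Qmat c 1)\<^sup>T
         else if k = 1 \<and> l = n then upper_entry c 1 n + U0mat c * (Vmat c n)\<^sup>T
         else if k > l then lower_entry c k l
         else upper_entry c k l)"
        by cases (use R kl n in auto)
    qed
  qed
  have upper: "?R3 \<longleftrightarrow> (\<forall>k l. 1 \<le> l \<longrightarrow> l < k \<longrightarrow> k \<le> n \<longrightarrow> block N A (n+1-k) (n+1-l) =
      (if k = n \<and> l = 1 then rev_ix n (Umat c) n * state (rev_ix n (Wmat c)) (rev_ix n (Vmat c)) n 1
          + U0mat c * (rev_ix n (Vmat c) 1)\<^sup>T
       else rev_ix n (Umat c) k * state (rev_ix n (Wmat c)) (rev_ix n (Vmat c)) k l))"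
    unfolding reverse_pairs
  proof (intro all_cong1 imp_cong refl)
    fix k l assume kl: "1 \<le> l" "l < k" "k \<le> n"
    have 1: "upper_entry c (n+1-k) (n+1-l) =
        rev_ix n (Umat c) k * state (rev_ix n (Wmat c)) (rev_ix n (Vmat c)) k l"
      using kl by (subst upper_entry_state[of _ _ n]) auto
    have "n+1-k = 1 \<and> n+1-l = n \<longleftrightarrow> k = n \<and> l = 1" using kl by auto
    then show "(block N A (n+1-k) (n+1-l) = ?up (n+1-k) (n+1-l)) \<longleftrightarrow> (block N A (n+1-k) (n+1-l) =
      (if k = n \<and> l = 1 then rev_ix n (Umat c) n * state (rev_ix n (Wmat c)) (rev_ix n (Vmat c)) n 1
          + U0mat c * (rev_ix n (Vmat c) 1)\<^sup>T
       else rev_ix n (Umat c) k * state (rev_ix n (Wmat c)) (rev_ix n (Vmat c)) k l))"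
      using 1 by (cases "k = n \<and> l = 1") auto
  qed
  have diag: "\<forall>i\<in>{1..n}. Dmat c i \<in> carrier_mat (N i) (N i)"
    if "\<forall>i\<in>{1..n}. block N A i i = Dmat c i"
  proof
    fix i assume i: "i \<in> {1..n}"
    then show "Dmat c i \<in> carrier_mat (N i) (N i)" using block_carrier[OF A i i] that by simp
  qed
  have perm: "(g \<and> g' \<and> d) \<and> p \<and> p' \<and> (r \<and> u \<and> w) \<longleftrightarrow> (g \<and> p' \<and> u) \<and> (g' \<and> p \<and> w) \<and> r"
    if "r \<Longrightarrow> d" for g g' d p p' r u w
    using that by blast
  \<comment> \<open>\<open>diff_add_inverse\<close> turns the reflected block size
    \<open>N (n + 1 - n)\<close> into \<open>N 1\<close>, the number of rows of
    \<open>U0mat\<close>.\<close>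
  show ?thesis unfolding is_css_def sss_dims_iff lower_css_rep_def
    unfolding blocks upper unfolding lower_entry_state diff_add_inverse by (rule perm) (rule diag)
qed

lemma state_cong:
  assumes "1 \<le> l" "l < k" "k \<le> n" "\<And>i. i \<in> {1..n} \<Longrightarrow> R i = R' i" "\<And>i. i \<in> {1..n} \<Longrightarrow> Q i = Q' i"
  shows "state R Q k l = state R' Q' k l"
  unfolding state_def using assms by (intro List.fold_cong) auto

text \<open>Ranks and generators are known to agree only at the indices that matter; outside them
  the functions are arbitrary, so they cannot be rewritten as equal functions.\<close>

lemma lower_rep_cong:
  assumes "lower_rep n N r P R Q B"
    and r: "\<And>i. 1 \<le> i \<Longrightarrow> i < n \<Longrightarrow> r i = r' i"
    and P: "\<And>i. i \<in> {1..n} \<Longrightarrow> P i = P' i" and R: "\<And>i. i \<in> {1..n} \<Longrightarrow> R i = R' i"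
    and Q: "\<And>i. i \<in> {1..n} \<Longrightarrow> Q i = Q' i"
    and B: "\<And>k l. 1 \<le> l \<Longrightarrow> l < k \<Longrightarrow> k \<le> n \<Longrightarrow> B k l = B' k l"
  shows "lower_rep n N r' P' R' Q' B'"
proof -
  have g: "generators n N r P R Q" using assms(1) by (simp add: lower_rep_def)
  have "generators n N r' P' R' Q'" unfolding generators_def
  proof (intro conjI ballI)
    fix i assume i: "i \<in> {2..n}"
    then have "1 \<le> i-1" "i-1 < n" by auto
    then show "P' i \<in> carrier_mat (N i) (r' (i-1))" using i P_carrier[OF g, of i] P[of i] r[of "i-1"] by simp
  next
    fix i assume i: "i \<in> {2..n-1}"
    then have "i < n" "1 \<le> i-1" "i-1 < n" by auto
    then show "R' i \<in> carrier_mat (r' i) (r' (i-1))"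
      using R_carrier[OF g, of i] R[of i] r[of "i-1"] r[of i] i by simp
  next
    fix i assume i: "i \<in> {1..n-1}"
    then have "i < n" by auto
    then show "Q' i \<in> carrier_mat (N i) (r' i)" using Q_carrier[OF g, of i] Q[of i] r[of i] i by simp
  qed
  moreover have "B' k l = P' k * state R' Q' k l" if kl: "1 \<le> l" "l < k" "k \<le> n" for k l
  proof -
    have "B k l = P k * state R Q k l" using assms(1) kl by (simp add: lower_rep_def)
    then show ?thesis using B[OF kl] P[of k] state_cong[OF kl R Q] kl by simp
  qed
  ultimately show ?thesis by (simp add: lower_rep_def)
qed

lemma lower_css_rep_cong:
  assumes "\<And>k l. 1 \<le> l \<Longrightarrow> l < k \<Longrightarrow> k \<le> n \<Longrightarrow> B k l = B' k l"
  shows "lower_css_rep n N r P R Q P0 B \<longleftrightarrow> lower_css_rep n N r P R Q P0 B'"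
  using assms unfolding lower_css_rep_def by (intro conj_cong refl all_cong1 imp_cong) auto

text \<open>The bounds on \<open>j\<close> ensure that exactly one index is reflected to
  \<open>j\<close>, in spite of truncated subtraction.\<close>

lemma rev_ix_update:
  assumes "1 \<le> j" "j \<le> n"
  shows "rev_ix n (f(j := x)) = (rev_ix n f)(n + 1 - j := x)"
proof
  fix i show "rev_ix n (f(j := x)) i = ((rev_ix n f)(n + 1 - j := x)) i" using assms by auto
qed

text \<open>The projections discard the corner \<open>(1,n)\<close>, so its value in
  \<open>Hmat\<close> may be traded for any \<open>Y\<close>. This lets all ranks be compared on
  A(X,Y) with \<open>Y\<close> fixed.\<close>

lemma mat_rank_Hmat:
  assumes A: "A \<in> carrier_mat (total_size n N) (total_size n N)" and n: "n \<ge> 2"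
    and X: "X \<in> carrier_mat (N n) (N 1)" and Y: "Y \<in> carrier_mat (N 1) (N n)" and i: "1 \<le> i" "i < n"
  shows "mat_rank (Hmat n N A i X) =
    mat_rank (block_proj n N {i+1..n} * replace_corners n N A X Y * block_proj n N {1..i})"
proof -
  interpret block_frame n N "total_size n N" "block_rows n N" "block_proj n N"
    by (rule block_frame_concrete)
  let ?M = "replace_corners n N A X (block N A 1 n)"
  have Y': "block N A 1 n \<in> carrier_mat (N 1) (N n)" by (rule block_carrier[OF A]) (use n in auto)
  note M = replace_corners_carrier[OF A]
  have "mat_rank (Hmat n N A i X) = mat_rank (block_proj n N {i+1..n} * ?M * block_proj n N {1..i})"
    unfolding Hmat_def lower_submatrix_def by (rule mat_rank_block_submatrix[OF M]) (use i in auto)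
  also have "block_proj n N {i+1..n} * ?M * block_proj n N {1..i} =
      block_proj n N {i+1..n} * replace_corners n N A X Y * block_proj n N {1..i}"
  proof (rule Pi_ext2[OF M M])
    fix k l assume "k \<in> {i+1..n}" "l \<in> {1..i}"
    then have kl: "k \<in> {1..n}" "l \<in> {1..n}" "\<not> (k = 1 \<and> l = n)" using i by auto
    show "block_rows n N k * ?M * (block_rows n N l)\<^sup>T =
        block_rows n N k * replace_corners n N A X Y * (block_rows n N l)\<^sup>T"
      unfolding block_eq_rows[OF M kl(1,2), symmetric]
        block_replace_corners[OF A n X Y kl(1,2)] block_replace_corners[OF A n X Y' kl(1,2)] if_not_P[OF kl(3)] by (rule refl)
  qed (use i in auto)
  finally show ?thesis .
qed

lemma mat_rank_Gmat:
  assumes A: "A \<in> carrier_mat (total_size n N) (total_size n N)" and n: "n \<ge> 2"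
    and X: "X \<in> carrier_mat (N n) (N 1)" and Y: "Y \<in> carrier_mat (N 1) (N n)" and i: "1 \<le> i" "i < n"
  shows "mat_rank (Gmat n N A i Y) =
    mat_rank (block_proj n N {1..i} * replace_corners n N A X Y * block_proj n N {i+1..n})"
proof -
  interpret block_frame n N "total_size n N" "block_rows n N" "block_proj n N"
    by (rule block_frame_concrete)
  let ?M = "replace_corners n N A (block N A n 1) Y"
  have X': "block N A n 1 \<in> carrier_mat (N n) (N 1)" by (rule block_carrier[OF A]) (use n in auto)
  note M = replace_corners_carrier[OF A]
  have "mat_rank (Gmat n N A i Y) = mat_rank (block_proj n N {1..i} * ?M * block_proj n N {i+1..n})"
    unfolding Gmat_def upper_submatrix_def by (rule mat_rank_block_submatrix[OF M]) (use i in auto)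
  also have "block_proj n N {1..i} * ?M * block_proj n N {i+1..n} =
      block_proj n N {1..i} * replace_corners n N A X Y * block_proj n N {i+1..n}"
  proof (rule Pi_ext2[OF M M])
    fix k l assume "k \<in> {1..i}" "l \<in> {i+1..n}"
    then have kl: "k \<in> {1..n}" "l \<in> {1..n}" "\<not> (k = n \<and> l = 1)" using i by auto
    show "block_rows n N k * ?M * (block_rows n N l)\<^sup>T =
        block_rows n N k * replace_corners n N A X Y * (block_rows n N l)\<^sup>T"
      unfolding block_eq_rows[OF M kl(1,2), symmetric]
        block_replace_corners[OF A n X Y kl(1,2)] block_replace_corners[OF A n X' Y kl(1,2)] if_not_P[OF kl(3)] by (rule refl)
  qed (use i in auto)
  finally show ?thesis .
qed

lemma reversed_intervals:
  fixes i n :: nat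
  assumes "1 \<le> i" "i < n"
  shows "(\<lambda>k. n+1-k) ` ({i+1..n} \<inter> {1..n}) = {1..n-i}"
    and "(\<lambda>k. n+1-k) ` ({1..i} \<inter> {1..n}) = {n-i+1..n}"
proof -
  have img: "(\<lambda>k. n+1-k) ` {a..b} = {n+1-b..n+1-a}" if "1 \<le> a" "a \<le> b" "b \<le> n" for a b
  proof
    show "{n+1-b..n+1-a} \<subseteq> (\<lambda>k. n+1-k) ` {a..b}"
    proof
      fix x assume "x \<in> {n+1-b..n+1-a}"
      then have "n+1-x \<in> {a..b}" "x = n+1-(n+1-x)" using that by auto
      then show "x \<in> (\<lambda>k. n+1-k) ` {a..b}" by (rule rev_image_eqI)
    qed
  qed (use that in auto)
  have "{i+1..n} \<inter> {1..n} = {i+1..n}" "{1..i} \<inter> {1..n} = {1..i}" using assms by auto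
  then show "(\<lambda>k. n+1-k) ` ({i+1..n} \<inter> {1..n}) = {1..n-i}"
    "(\<lambda>k. n+1-k) ` ({1..i} \<inter> {1..n}) = {n-i+1..n}"
    using img[of "i+1" n] img[of 1 i] assms by (auto simp: Suc_diff_le)
qed

text \<open>As the construction is a relation, the existence of an output is claimed separately;
  otherwise the statement about all outputs could hold vacuously. The minima are infima of nonempty
  sets of natural numbers, hence attained.\<close>

theorem theorem3p1:
  fixes n :: nat and N :: "nat \<Rightarrow> nat" and A Xhat Yhat :: "real mat"
  assumes "n \<ge> 3"
    and "A \<in> carrier_mat (total_size n N) (total_size n N)"
    and "Xhat \<in> carrier_mat (N n) (N 1)"
    and "Yhat \<in> carrier_mat (N 1) (N n)"
    and "\<forall>i\<in>{1..n-1}. mat_rank (Hmat n N A i Xhat) =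
           (INF X\<in>carrier_mat (N n) (N 1). mat_rank (Hmat n N A i X))"
    and "\<forall>i\<in>{1..n-1}. mat_rank (Gmat n N A i Yhat) =
           (INF Y\<in>carrier_mat (N 1) (N n). mat_rank (Gmat n N A i Y))"
  shows "(\<exists>c. css_construction n N A Xhat Yhat c) \<and>
         (\<forall>c. css_construction n N A Xhat Yhat c \<longrightarrow>
            is_css n N A c \<and>
            (\<forall>c'. is_css n N A c' \<longrightarrow>
               (\<forall>i\<in>{1..n-1}. rh c i \<le> rh c' i \<and> rg c i \<le> rg c' i)))"
proof -
  note n = assms(1) and A = assms(2) and X = assms(3) and Y = assms(4)
  have n2: "n \<ge> 2" using n by simp
  let ?T = "total_size n N" and ?E = "block_rows n N" and ?Pi = "block_proj n N"
  define M where "M = replace_corners n N A Xhat Yhat"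
  have M: "M \<in> carrier_mat ?T ?T" unfolding M_def by (rule replace_corners_carrier[OF A])
  have rc: "block N (replace_corners n N A X' Y') k l =
      (if k = n \<and> l = 1 then X' else if k = 1 \<and> l = n then Y' else block N A k l)"
    if "X' \<in> carrier_mat (N n) (N 1)" "Y' \<in> carrier_mat (N 1) (N n)" "k \<in> {1..n}" "l \<in> {1..n}" for X' Y' k l
    by (rule block_replace_corners[OF A n2 that])
  interpret bf: block_frame n N ?T ?E ?Pi by (rule block_frame_concrete)
  interpret lo: corner_frame n N ?T ?E ?Pi A "\<lambda>X. replace_corners n N A X Yhat"
  proof
    fix X' :: "real mat" and k l assume X': "X' \<in> carrier_mat (N n) (N 1)" and kl: "1 \<le> l" "l < k" "k \<le> n"
    then have ix: "k \<in> {1..n}" "l \<in> {1..n}" "\<not> (k = 1 \<and> l = n)" by auto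
    show "?E k * replace_corners n N A X' Yhat * (?E l)\<^sup>T = (if k = n \<and> l = 1 then X' else ?E k * A * (?E l)\<^sup>T)"
      unfolding block_eq_rows[OF A ix(1,2), symmetric]
        block_eq_rows[OF replace_corners_carrier[OF A] ix(1,2), symmetric] rc[OF X' Y ix(1,2)] if_not_P[OF ix(3)]
      by (rule refl)
  qed (use n A replace_corners_carrier[OF A] in auto)
  interpret rv: block_frame n "rev_ix n N" ?T "rev_ix n ?E" "\<lambda>K. ?Pi ((\<lambda>k. n+1-k) ` (K \<inter> {1..n}))"
    by (rule bf.block_frame_rev)
  \<comment> \<open>Backwards numbering sends the corner \<open>(1,n)\<close> to
    \<open>(n,1)\<close>; now \<open>Xhat\<close> is held fixed and \<open>Y\<close> is the free
    corner.\<close>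
  interpret up: corner_frame n "rev_ix n N" ?T "rev_ix n ?E" "\<lambda>K. ?Pi ((\<lambda>k. n+1-k) ` (K \<inter> {1..n}))" A
    "\<lambda>Y. replace_corners n N A Xhat Y"
  proof
    fix Y' :: "real mat" and k l assume "Y' \<in> carrier_mat (rev_ix n N n) (rev_ix n N 1)" and kl: "1 \<le> l" "l < k" "k \<le> n"
    then have Y': "Y' \<in> carrier_mat (N 1) (N n)" by simp
    have ix: "n+1-k \<in> {1..n}" "n+1-l \<in> {1..n}" "\<not> (n+1-k = n \<and> n+1-l = 1)"
      "n+1-k = 1 \<and> n+1-l = n \<longleftrightarrow> k = n \<and> l = 1" using kl by auto
    show "?E (n+1-k) * replace_corners n N A Xhat Y' * (?E (n+1-l))\<^sup>T =
        (if k = n \<and> l = 1 then Y' else ?E (n+1-k) * A * (?E (n+1-l))\<^sup>T)"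
      unfolding block_eq_rows[OF A ix(1,2), symmetric]
        block_eq_rows[OF replace_corners_carrier[OF A] ix(1,2), symmetric] rc[OF X Y' ix(1,2)]
        if_not_P[OF ix(3)] ix(4)
      by (rule refl)
  qed (use n A replace_corners_carrier[OF A] in auto)

  have lo_blk: "lo.blk B k l = block N B k l" if "B \<in> carrier_mat ?T ?T" "k \<in> {1..n}" "l \<in> {1..n}" for B k l
    using block_eq_rows[OF that] by simp
  have up_blk: "up.blk B k l = block N B (n+1-k) (n+1-l)"
    if "B \<in> carrier_mat ?T ?T" "k \<in> {1..n}" "l \<in> {1..n}" for B k l
    by (rule block_eq_rows[OF that(1), symmetric]) (use that(2,3) in auto)
  have lo_rank: "lo.lower_rank i M = mat_rank (lower_submatrix n N M i)" if "1 \<le> i" "i < n" for i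
    unfolding lower_submatrix_def by (rule mat_rank_block_submatrix[OF M, symmetric]) (use that in auto)
  have up_rank': "up.lower_rank i B = mat_rank (?Pi {1..n-i} * B * ?Pi {n-i+1..n})" if "1 \<le> i" "i < n" for i B
    unfolding reversed_intervals[OF that] ..
  have up_rank: "up.lower_rank i M = mat_rank (upper_submatrix n N M (n-i))" if "1 \<le> i" "i < n" for i
    unfolding upper_submatrix_def up_rank'[OF that] by (rule mat_rank_block_submatrix[OF M, symmetric]) (use that in auto)
  have lo_min: "lo.lower_rank i (replace_corners n N A Xhat Yhat) \<le> lo.lower_rank i (replace_corners n N A X' Yhat)"
    if "1 \<le> i" "i < n" "X' \<in> carrier_mat (N n) (N 1)" for i X'
  proof -
    have "mat_rank (Hmat n N A i Xhat) \<le> mat_rank (Hmat n N A i X')"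
      using assms(5) that by (auto intro: cINF_lower)
    then show ?thesis using mat_rank_Hmat[OF A n2 X Y that(1,2)] mat_rank_Hmat[OF A n2 that(3) Y that(1,2)] by simp
  qed
  have up_min: "up.lower_rank i (replace_corners n N A Xhat Yhat) \<le> up.lower_rank i (replace_corners n N A Xhat Y')"
    if i: "1 \<le> i" "i < n" and Y': "Y' \<in> carrier_mat (rev_ix n N n) (rev_ix n N 1)" for i Y'
  proof -
    have ni: "1 \<le> n-i" "n-i < n" and Y': "Y' \<in> carrier_mat (N 1) (N n)" using that by auto
    \<comment> \<open>Level \<open>i\<close> of the reversed frame is the upper submatrix at
      \<open>n - i\<close>.\<close>
    have "mat_rank (Gmat n N A (n-i) Yhat) \<le> mat_rank (Gmat n N A (n-i) Y')"
      using assms(6) ni Y' by (auto intro: cINF_lower)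
    then show ?thesis unfolding up_rank'[OF i]
      using mat_rank_Gmat[OF A n2 X Y ni] mat_rank_Gmat[OF A n2 X Y' ni] by simp
  qed
  have Y': "Yhat \<in> carrier_mat (rev_ix n N n) (rev_ix n N 1)" using Y by simp

  have "\<exists>s. is_minimal_sss n N M s"
  proof -
    obtain P R Q where lo: "generators n N (\<lambda>i. lo.lower_rank i M) P R Q"
        "\<And>k l. 1 \<le> l \<Longrightarrow> l < k \<Longrightarrow> k \<le> n \<Longrightarrow> lo.blk M k l = P k * state R Q k l"
      using bf.minimal_generators_exist[OF M] by blast
    obtain P' R' Q' where up: "generators n (rev_ix n N) (\<lambda>i. up.lower_rank i M) P' R' Q'"
        "\<And>k l. 1 \<le> l \<Longrightarrow> l < k \<Longrightarrow> k \<le> n \<Longrightarrow> up.blk M k l = P' k * state R' Q' k l"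
      using rv.minimal_generators_exist[OF M] by blast
    \<comment> \<open>The upper generators were built in reversed numbering, and
      \<open>rev_ix\<close> restores the original one. The dimensions are set to the ranks, so
      minimality holds by definition.\<close>
    define s where "s = \<lparr> rg = (\<lambda>i. mat_rank (upper_submatrix n N M i)),
      rh = (\<lambda>i. mat_rank (lower_submatrix n N M i)),
      Umat = rev_ix n P', Wmat = rev_ix n R', Vmat = rev_ix n Q', Dmat = (\<lambda>i. block N M i i),
      Pmat = P, Rmat = R, Qmat = Q \<rparr>"
    have "lower_rep n N (\<lambda>i. lo.lower_rank i M) P R Q (lo.blk M)" using lo by (simp add: lower_rep_def)
    then have 1: "lower_rep n N (rh s) (Pmat s) (Rmat s) (Qmat s) (block N M)"
    proof (rule lower_rep_cong)
      show "lo.lower_rank i M = rh s i" if "1 \<le> i" "i < n" for i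
        unfolding lo_rank[OF that] by (simp add: s_def)
      show "lo.blk M k l = block N M k l" if "1 \<le> l" "l < k" "k \<le> n" for k l
        by (rule lo_blk[OF M]) (use that in auto)
    qed (auto simp: s_def)
    have "lower_rep n (rev_ix n N) (\<lambda>i. up.lower_rank i M) P' R' Q' (up.blk M)" using up by (simp add: lower_rep_def)
    then have 2: "lower_rep n (rev_ix n N) (\<lambda>i. rg s (n - i)) (rev_ix n (Umat s)) (rev_ix n (Wmat s))
        (rev_ix n (Vmat s)) (\<lambda>k l. block N M (n+1-k) (n+1-l))"
    proof (rule lower_rep_cong)
      show "up.lower_rank i M = rg s (n - i)" if "1 \<le> i" "i < n" for i
        unfolding up_rank[OF that] by (simp add: s_def)
      show "up.blk M k l = block N M (n+1-k) (n+1-l)" if "1 \<le> l" "l < k" "k \<le> n" for k l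
        by (rule up_blk[OF M]) (use that in auto)
    qed (auto simp: s_def)
    have "is_sss n N M s" using 1 2 by (simp add: is_sss_iff[OF M]) (simp add: s_def)
    then have "is_minimal_sss n N M s" by (simp add: is_minimal_sss_def s_def)
    then show ?thesis ..
  qed
  then obtain s where s: "is_minimal_sss n N M s" ..
  obtain Z B where B: "rank_factorization ((Qmat s 1)\<^sup>T @\<^sub>r (block N A n 1 - Xhat)) Z B"
    using rank_factorization_exists by blast
  obtain Z' B' where B': "rank_factorization ((Vmat s n)\<^sup>T @\<^sub>r (block N A 1 n - Yhat)) Z' B'"
    using rank_factorization_exists by blast
  have ex: "\<exists>c. css_construction n N A Xhat Yhat c"
    unfolding css_construction_def M_def[symmetric]
    by (rule exI, rule exI[of _ s], rule exI[of _ Z], rule exI[of _ "B\<^sup>T"], rule exI[of _ Z'], rule exI[of _ "B'\<^sup>T"])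
      (use s B B' in simp)

  have "is_css n N A c \<and> (\<forall>c'. is_css n N A c' \<longrightarrow> (\<forall>i\<in>{1..n-1}. rh c i \<le> rh c' i \<and> rg c i \<le> rg c' i))"
    if cc: "css_construction n N A Xhat Yhat c" for c
  proof -
    obtain s Z Q1 Z' Vn where s: "is_minimal_sss n N M s"
      and fQ: "rank_factorization ((Qmat s 1)\<^sup>T @\<^sub>r (block N A n 1 - Xhat)) Z Q1\<^sup>T"
      and fV: "rank_factorization ((Vmat s n)\<^sup>T @\<^sub>r (block N A 1 n - Yhat)) Z' Vn\<^sup>T"
      and c: "c = \<lparr> rg = (rg s)(n-1 := dim_col Vn),
           rh = (rh s)(1 := dim_col Q1),
           Umat = (Umat s)(n-1 := Umat s (n-1) * (Vmat s n)\<^sup>T * pinv (Vn\<^sup>T)),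
           Wmat = (Wmat s)(n-1 := Wmat s (n-1) * (Vmat s n)\<^sup>T * pinv (Vn\<^sup>T)),
           Vmat = (Vmat s)(n := Vn),
           Dmat = Dmat s,
           Pmat = (Pmat s)(2 := Pmat s 2 * (Qmat s 1)\<^sup>T * pinv (Q1\<^sup>T)),
           Rmat = (Rmat s)(2 := Rmat s 2 * (Qmat s 1)\<^sup>T * pinv (Q1\<^sup>T)),
           Qmat = (Qmat s)(1 := Q1),
           U0mat = (block N A 1 n - Yhat) * pinv (Vn\<^sup>T),
           P0mat = (block N A n 1 - Xhat) * pinv (Q1\<^sup>T) \<rparr>"
      using cc unfolding css_construction_def M_def[symmetric] by blast
    have sss: "is_sss n N M s" using s by (simp add: is_minimal_sss_def)
    then have "lower_rep n N (rh s) (Pmat s) (Rmat s) (Qmat s) (block N M)"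
      by (simp add: is_sss_iff[OF M])
    then have lo: "lower_rep n N (rh s) (Pmat s) (Rmat s) (Qmat s) (lo.blk M)"
      by (rule lower_rep_cong) (auto simp: lo_blk[OF M, simplified])
    have "lower_rep n (rev_ix n N) (\<lambda>i. rg s (n - i)) (rev_ix n (Umat s)) (rev_ix n (Wmat s)) (rev_ix n (Vmat s))
        (\<lambda>k l. block N M (n+1-k) (n+1-l))"
      using sss unfolding is_sss_iff[OF M] by blast
    then have up: "lower_rep n (rev_ix n N) (\<lambda>i. rg s (n - i)) (rev_ix n (Umat s)) (rev_ix n (Wmat s))
        (rev_ix n (Vmat s)) (up.blk M)"
    proof (rule lower_rep_cong)
      show "block N M (n+1-k) (n+1-l) = up.blk M k l" if "1 \<le> l" "l < k" "k \<le> n" for k l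
        by (rule up_blk[OF M, symmetric]) (use that in auto)
    qed auto
    have fQ': "rank_factorization ((Qmat s 1)\<^sup>T @\<^sub>r (lo.blk A n 1 - Xhat)) Z Q1\<^sup>T"
      by (subst lo_blk[OF A]) (use fQ n in auto)
    have "up.blk A n 1 = block N A 1 n" by (subst up_blk[OF A]) (use n in auto)
    then have fV': "rank_factorization ((rev_ix n (Vmat s) 1)\<^sup>T @\<^sub>r (up.blk A n 1 - Yhat)) Z' Vn\<^sup>T"
      using fV by simp
    note lo' = lo[unfolded M_def] and up' = up[unfolded M_def]
    have lo_cong: "lower_css_rep n N r P R Q P0 (lo.blk A) \<longleftrightarrow> lower_css_rep n N r P R Q P0 (block N A)"
      for r P R Q P0
      by (rule lower_css_rep_cong, rule lo_blk[OF A]) auto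
    have up_cong: "lower_css_rep n (rev_ix n N) r P R Q P0 (up.blk A) \<longleftrightarrow>
        lower_css_rep n (rev_ix n N) r P R Q P0 (\<lambda>k l. block N A (n+1-k) (n+1-l))" for r P R Q P0
      by (rule lower_css_rep_cong, rule up_blk[OF A]) auto
    \<comment> \<open>Reversal moves the updates at \<open>n - 1\<close> to 1 for the dimensions and
      to 2 for \<open>Umat\<close> and \<open>Wmat\<close>, and the update at \<open>n\<close> to 1
      for \<open>Vmat\<close>. So the upper half of \<open>c\<close> has exactly the form of the
      lower construction.\<close>
    have rg_c: "(\<lambda>i. rg c (n - i)) = (\<lambda>i. rg s (n - i))(1 := dim_col Vn)"
      using n by (auto simp: c)
    have rev_c: "rev_ix n (Umat c) = (rev_ix n (Umat s))(2 := rev_ix n (Umat s) 2 * (rev_ix n (Vmat s) 1)\<^sup>T * pinv (Vn\<^sup>T))"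
      "rev_ix n (Wmat c) = (rev_ix n (Wmat s))(2 := rev_ix n (Wmat s) 2 * (rev_ix n (Vmat s) 1)\<^sup>T * pinv (Vn\<^sup>T))"
      "rev_ix n (Vmat c) = (rev_ix n (Vmat s))(1 := Vn)"
    proof -
      have "n + 1 - (n-1) = 2" "n + 1 - n = 1" "n + 1 - 2 = n - 1" using n by auto
      then show "rev_ix n (Umat c) = (rev_ix n (Umat s))(2 := rev_ix n (Umat s) 2 * (rev_ix n (Vmat s) 1)\<^sup>T * pinv (Vn\<^sup>T))"
        "rev_ix n (Wmat c) = (rev_ix n (Wmat s))(2 := rev_ix n (Wmat s) 2 * (rev_ix n (Vmat s) 1)\<^sup>T * pinv (Vn\<^sup>T))"
        "rev_ix n (Vmat c) = (rev_ix n (Vmat s))(1 := Vn)"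
        using rev_ix_update[of "n-1" n "Umat s"] rev_ix_update[of "n-1" n "Wmat s"] rev_ix_update[of n n "Vmat s"] n
        by (simp_all add: c del: fun_upd_apply)
    qed
    have "lower_css_rep n N (rh c) (Pmat c) (Rmat c) (Qmat c) (P0mat c) (block N A)"
      using lo.css_rep_of_factorization[OF X lo' fQ'] lo_blk[OF A, of n 1] n
      unfolding lo_cong by (simp add: c del: fun_upd_apply)
    moreover have "lower_css_rep n (rev_ix n N) (\<lambda>i. rg c (n - i)) (rev_ix n (Umat c)) (rev_ix n (Wmat c))
        (rev_ix n (Vmat c)) (U0mat c) (\<lambda>k l. block N A (n+1-k) (n+1-l))"
    proof -
      have "U0mat c = (up.blk A n 1 - Yhat) * pinv (Vn\<^sup>T)"
        unfolding \<open>up.blk A n 1 = block N A 1 n\<close> by (simp add: c)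
      then show ?thesis unfolding rg_c rev_c up_cong[symmetric]
        using up.css_rep_of_factorization[OF Y' up' fV'] by simp
    qed
    moreover have "\<forall>i\<in>{1..n}. block N A i i = Dmat c i"
    proof
      fix i assume i: "i \<in> {1..n}"
      have "block N A i i = block N M i i" unfolding M_def using rc[OF X Y i i] n by auto
      also have "\<dots> = Dmat s i" using sss i unfolding is_sss_iff[OF M] by blast
      finally show "block N A i i = Dmat c i" by (simp add: c)
    qed
    ultimately have "is_css n N A c" unfolding is_css_iff[OF A n] by blast
    moreover have "rh c i \<le> rh c' i \<and> rg c i \<le> rg c' i" if c': "is_css n N A c'" and i: "i \<in> {1..n-1}" for c' i
    proof
      have i: "1 \<le> i" "i < n" and ni: "1 \<le> n - i" "n - i < n" "n - (n - i) = i" using i by auto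
      have rep: "lower_css_rep n N (rh c') (Pmat c') (Rmat c') (Qmat c') (P0mat c') (lo.blk A)"
        using c' unfolding is_css_iff[OF A n] lo_cong by blast
      have "((rh s)(1 := dim_col Q1)) i \<le> rh c' i"
      proof (rule lo.uniformly_minimal[OF X lo_min lo' _ fQ' rep i])
        show "rh s i = lo.lower_rank i (replace_corners n N A Xhat Yhat)" if "1 \<le> i" "i < n" for i
          unfolding M_def[symmetric] lo_rank[OF that] using s that by (simp add: is_minimal_sss_def)
      qed
      then show "rh c i \<le> rh c' i" by (simp add: c)
      have rep: "lower_css_rep n (rev_ix n N) (\<lambda>i. rg c' (n - i)) (rev_ix n (Umat c')) (rev_ix n (Wmat c'))
          (rev_ix n (Vmat c')) (U0mat c') (up.blk A)"
        using c' unfolding is_css_iff[OF A n] up_cong by blast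
      \<comment> \<open>The reversed bound is taken at level \<open>n - i\<close> so that it speaks
        about dimension \<open>i\<close> in the original numbering.\<close>
      have "((\<lambda>i. rg s (n - i))(1 := dim_col Vn)) (n - i) \<le> rg c' (n - (n - i))"
      proof (rule up.uniformly_minimal[OF Y' up_min up' _ fV' rep ni(1,2)])
        show "rg s (n - i) = up.lower_rank i (replace_corners n N A Xhat Yhat)" if "1 \<le> i" "i < n" for i
        proof -
          have "n - i \<in> {1..n-1}" using that by auto
          then show ?thesis
            unfolding M_def[symmetric] up_rank[OF that] using s unfolding is_minimal_sss_def by blast
        qed
      qed
      then show "rg c i \<le> rg c' i" unfolding rg_c[symmetric] ni(3) .
    qed
    ultimately show ?thesis by blast
  qed
  then show ?thesis using ex by blast
qed

end
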